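(* Let $I:(0,\infty)\to(0,\infty)$ be a non-decreasing function and let $\|\cdot\|_X$ and $\|\cdot\|_Y$ be rearrangement invariant Banach function norms over $((0,\infty),\lambda)$, where $\lambda$ is the Lebesgue measure. Let $X$ be the corresponding Banach function space of $\|\cdot\|_X$. Then the following statements are equivalent: (i) There exists a constant $C\in\mathbb{R}$ such that $$\left\| \int_t^{\infty} \frac{f(s)}{I(s)}\, ds \right\|_Y \le C\,\|f\|_X$$ for all non-negative $f\in X$. (ii) There exists a constant $C'\in\mathbb{R}$ such that $$\left\| \int_t^{\infty} \frac{f(s)}{I(s)}\, ds \right\|_Y \le C'\,\|f\|_X$$ for all non-increasing non-negative $f\in X$. Furthermore, if (ii) holds with a constant $C'$, then (i) holds with $C=4C'$. (In both inequalities the norm $\|\cdot\|_Y$ is applied to the displayed integral as a function of $t\in(0,\infty)$.)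
   Context: Let $\lambda$ be Lebesgue measure on $(0,\infty)$, let $M$ be the set of all (extended complex-valued) $\lambda$-measurable functions on $(0,\infty)$, and let $M_+$ be the set of non-negative measurable functions on $(0,\infty)$, with values in $[0,\infty]$; functions equal $\lambda$-a.e. are identified. For $f\in M_+$ the distribution function is $\lambda_f(s)=\lambda(\{t\in(0,\infty): f(t)>s\})$, $s\in[0,\infty)$. Two functions $f,g\in M_+$ are equimeasurable if $\lambda_f=\lambda_g$. A functional $\|\cdot\|:M_+\to[0,\infty]$ is a Banach function norm if: (P1) it is positively homogeneous, subadditive, and $\|f\|=0$ if and only if $f=0$ a.e.; (P2) $f\le g$ a.e. implies $\|f\|\le\|g\|$; (P3) if $f_n,f\in M_+$ and $f_n\uparrow f$ a.e., then $\|f_n\|\uparrow\|f\|$; (P4) $\|\chi_E\|<\infty$ for every measurable $E\subseteq(0,\infty)$ with $\lambda(E)<\infty$; (P5) for every measurable $E\subseteq(0,\infty)$ with $\lambda(E)<\infty$ there is a finite constant $C_E$, depending only on $E$, such that $\int_E f\,d\lambda\le C_E\|f\|$ for all $f\in M_+$. It is rearrangement invariant if moreover (P6) $\|f\|=\|g\|$ whenever $f,g\in M_+$ are equimeasurable. A Banach function norm is extended to $M$ by $\|f\|:=\|\,|f|\,\|$, and the corresponding Banach function space is $X=\{f\in M:\|f\|_X<\infty\}$. *)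

theory Defs
  imports "HOL-Analysis.Analysis"
begin

text \<open>
  Functions on \<open>(0,\<infinity>)\<close> are total functions on \<open>real\<close> whose values outside
  \<open>{0<..}\<close> are irrelevant: measurability, null sets and integrals all refer to the
  following measure, and the almost-everywhere monotonicity of a Banach function norm makes
  it agree on functions that are equal almost everywhere on \<open>{0<..}\<close>.
\<close>

abbreviation pos_lebesgue :: "real measure" where
  "pos_lebesgue \<equiv> lebesgue_on {0<..}"

definition M_plus :: "(real \<Rightarrow> ennreal) set" where
  "M_plus = borel_measurable pos_lebesgue"

definition distribution_function :: "(real \<Rightarrow> ennreal) \<Rightarrow> real \<Rightarrow> ennreal" where
  "distribution_function f s = emeasure pos_lebesgue {t \<in> {0<..}. f t > ennreal s}"

definition equimeasurable :: "(real \<Rightarrow> ennreal) \<Rightarrow> (real \<Rightarrow> ennreal) \<Rightarrow> bool" where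
  "equimeasurable f g \<longleftrightarrow>
     (\<forall>s\<ge>0. distribution_function f s = distribution_function g s)"

text \<open>
  The last conjunct asks for a finite constant: in \<^typ>\<open>ennreal\<close>, \<open>0 * \<infinity> = 0\<close>, but the
  constant may always be enlarged, so the convention does not affect the condition.
\<close>

definition banach_function_norm :: "((real \<Rightarrow> ennreal) \<Rightarrow> ennreal) \<Rightarrow> bool" where
  "banach_function_norm N \<longleftrightarrow>
     (\<forall>f\<in>M_plus. \<forall>a::real. a \<ge> 0 \<longrightarrow> N (\<lambda>t. ennreal a * f t) = ennreal a * N f) \<and>
     (\<forall>f\<in>M_plus. \<forall>g\<in>M_plus. N (\<lambda>t. f t + g t) \<le> N f + N g) \<and>
     (\<forall>f\<in>M_plus. N f = 0 \<longleftrightarrow> (AE t in pos_lebesgue. f t = 0)) \<and>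
     (\<forall>f\<in>M_plus. \<forall>g\<in>M_plus. (AE t in pos_lebesgue. f t \<le> g t) \<longrightarrow> N f \<le> N g) \<and>
     (\<forall>F f. (\<forall>n::nat. F n \<in> M_plus) \<longrightarrow> f \<in> M_plus \<longrightarrow>
        (AE t in pos_lebesgue. incseq (\<lambda>n. F n t) \<and> (\<lambda>n. F n t) \<longlonglongrightarrow> f t) \<longrightarrow>
        incseq (\<lambda>n. N (F n)) \<and> (\<lambda>n. N (F n)) \<longlonglongrightarrow> N f) \<and>
     (\<forall>E\<in>sets pos_lebesgue. emeasure pos_lebesgue E < \<infinity> \<longrightarrow> N (indicator E) < \<infinity>) \<and>
     (\<forall>E\<in>sets pos_lebesgue. emeasure pos_lebesgue E < \<infinity> \<longrightarrow>
        (\<exists>C::real. \<forall>f\<in>M_plus. (\<integral>\<^sup>+t\<in>E. f t \<partial>pos_lebesgue) \<le> ennreal C * N f))"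

definition rearrangement_invariant_norm :: "((real \<Rightarrow> ennreal) \<Rightarrow> ennreal) \<Rightarrow> bool" where
  "rearrangement_invariant_norm N \<longleftrightarrow>
     banach_function_norm N \<and>
     (\<forall>f\<in>M_plus. \<forall>g\<in>M_plus. equimeasurable f g \<longrightarrow> N f = N g)"

text \<open>
  The non-negative elements of the Banach function space of \<open>N\<close>. For \<open>f \<ge> 0\<close> the
  extension \<open>N \<bar>f\<bar>\<close> of the norm to all measurable functions is \<open>N f\<close>.
\<close>

definition nonneg_space :: "((real \<Rightarrow> ennreal) \<Rightarrow> ennreal) \<Rightarrow> (real \<Rightarrow> ennreal) set" where
  "nonneg_space N = {f \<in> M_plus. N f < \<infinity>}"

definition tail_integral :: "(real \<Rightarrow> real) \<Rightarrow> (real \<Rightarrow> ennreal) \<Rightarrow> real \<Rightarrow> ennreal" where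
  "tail_integral I f t = (\<integral>\<^sup>+s\<in>{t<..}. f s / ennreal (I s) \<partial>pos_lebesgue)"

text \<open>
  The bound is stated in \<^typ>\<open>ereal\<close> because \<open>ennreal C\<close> would turn a negative constant
  into \<open>0\<close>.
\<close>

definition tail_bound ::
  "(real \<Rightarrow> real) \<Rightarrow> ((real \<Rightarrow> ennreal) \<Rightarrow> ennreal) \<Rightarrow> ((real \<Rightarrow> ennreal) \<Rightarrow> ennreal) \<Rightarrow>
   real \<Rightarrow> (real \<Rightarrow> ennreal) \<Rightarrow> bool" where
  "tail_bound I X Y C f \<longleftrightarrow>
     enn2ereal (Y (tail_integral I f)) \<le> ereal C * enn2ereal (X f)"

definition nonincreasing :: "(real \<Rightarrow> ennreal) \<Rightarrow> bool" where
  "nonincreasing f \<longleftrightarrow> monotone_on {0<..} (\<le>) (\<ge>) f"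

end

theory Submission
  imports Defs
begin

text \<open>
  Write \<open>H f\<close> for the tail integral of \<open>f / I\<close>. It suffices to find, for a given \<open>f\<close>, a
  non-increasing \<open>\<beta>\<close> with \<open>X \<beta> \<le> X f\<close> and \<open>H f t \<le> 2 * H \<beta> (t / 2)\<close>, because dilation by 2
  costs another factor 2 in \<open>Y\<close>. For \<open>\<beta>\<close> one takes a discrete level function of \<open>f\<close>: replace \<open>f\<close>
  by its averages over cells of length \<open>\<delta>\<close>, then average further over the blocks on which the least
  concave majorant of the primitive is affine. Averaging over an interval does not increase a
  rearrangement invariant norm: on that interval \<open>f\<close> may be replaced by its decreasing
  rearrangement, and averages of cyclic rotations of step functions below it exhaust the mean.
  If the block of \<open>t\<close> starts at \<open>a\<close>, then \<open>f\<close> and \<open>\<beta>\<close> have the same mass on \<open>(0, a]\<close>, so testing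
  the majorization on \<open>(a, \<infinity>)\<close> against the non-increasing weight \<open>s \<mapsto> 1 / I (max s t)\<close> gives
  \<open>H f t \<le> t * \<beta> t / I t + H \<beta> t\<close>, and the first summand is at most twice the
  integral of \<open>\<beta> / I\<close> over \<open>(t / 2, t]\<close>. The truncations and the shift by \<open>2\<delta>\<close> caused by the
  discretization disappear in the limit \<open>\<delta> \<rightarrow> 0\<close> by the Fatou property.
\<close>

section \<open>Level sequences\<close>

definition block_average :: "nat \<Rightarrow> nat \<Rightarrow> (nat \<Rightarrow> real) \<Rightarrow> nat \<Rightarrow> real" where
  "block_average k l c j = (if k \<le> j \<and> j < l then (\<Sum>i=k..<l. c i) / real (l - k) else c j)"

text \<open>Abel summation: the differences \<open>M - a j\<close> have non-negative partial sums
  and total 0, so a non-increasing weight, which favours the early terms, gives them a non-negative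
  weighted sum.\<close>

lemma weighted_sum_le_of_partial_sums_le:
  fixes a w :: "nat \<Rightarrow> real"
  assumes w: "antimono w" and "p < q"
    and le: "\<And>x. p < x \<Longrightarrow> x \<le> q \<Longrightarrow> (\<Sum>j=p..<x. a j) \<le> real (x - p) * M"
    and eq: "(\<Sum>j=p..<q. a j) = real (q - p) * M"
  shows "(\<Sum>j=p..<q. w j * a j) \<le> (\<Sum>j=p..<q. w j * M)"
proof -
  \<comment> \<open>Going from \<open>x\<close> to \<open>Suc x\<close> lowers the coefficient of a
    non-negative partial sum from \<open>w (x - 1)\<close> to \<open>w x\<close>. At
    \<open>x = q\<close> the left-hand side is 0.\<close>
  have abel: "w (x - 1) * (\<Sum>j=p..<x. M - a j) \<le> (\<Sum>j=p..<x. w j * (M - a j))"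
    if "p < x" "x \<le> q" for x
    using that
  proof (induction x)
    case (Suc x)
    show ?case
    proof (cases "p = x")
      case False
      with Suc.prems have px: "p < x" "x \<le> q" by auto
      have "0 \<le> (\<Sum>j=p..<x. M - a j)"
        using le[OF px] by (simp add: sum_subtractf)
      moreover have "w x \<le> w (x - 1)" using w by (simp add: antimonoD)
      ultimately have "w x * (\<Sum>j=p..<x. M - a j) \<le> w (x - 1) * (\<Sum>j=p..<x. M - a j)"
        by (rule mult_right_mono[rotated])
      with Suc.IH[OF px] px show ?thesis by (simp add: distrib_left)
    qed simp
  qed simp
  have "(\<Sum>j=p..<q. M - a j) = 0"
    using eq by (simp add: sum_subtractf)
  with abel[of q] \<open>p < q\<close> have "0 \<le> (\<Sum>j=p..<q. w j * (M - a j))" by simp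
  then show ?thesis by (simp add: right_diff_distrib sum_subtractf)
qed

text \<open>
  Discrete level function (the slopes of the least concave majorant of the partial sums).
  Closedness of \<open>b\<close> under every family \<open>S\<close> records that it arises from \<open>a\<close> by finitely many
  block averages.
\<close>

definition level_sequence :: "nat \<Rightarrow> nat \<Rightarrow> (nat \<Rightarrow> real) \<Rightarrow> (nat \<Rightarrow> real) \<Rightarrow> bool" where
  "level_sequence p n a b \<longleftrightarrow>
    (\<forall>j. j \<notin> {p..<n} \<longrightarrow> b j = a j) \<and>
    (\<forall>i j. p \<le> i \<longrightarrow> i \<le> j \<longrightarrow> j < n \<longrightarrow> b j \<le> b i) \<and>
    (\<forall>M. p < n \<longrightarrow> (\<forall>x. p < x \<longrightarrow> x \<le> n \<longrightarrow> (\<Sum>j=p..<x. a j) \<le> real (x - p) * M) \<longrightarrow> b p \<le> M) \<and>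
    (\<forall>k. p \<le> k \<longrightarrow> k < n \<longrightarrow> (\<exists>m. p \<le> m \<and> m \<le> k \<and> (\<forall>j. m \<le> j \<longrightarrow> j \<le> k \<longrightarrow> b j = b k) \<and>
       (\<forall>w::nat \<Rightarrow> real. antimono w \<longrightarrow> (\<Sum>j=m..<n. w j * a j) \<le> (\<Sum>j=m..<n. w j * b j)))) \<and>
    (\<forall>S. a \<in> S \<longrightarrow> (\<forall>c\<in>S. \<forall>k l. k < l \<longrightarrow> l \<le> n \<longrightarrow> block_average k l c \<in> S) \<longrightarrow> b \<in> S)"

text \<open>Induction on \<open>n - p\<close>. The first block ends at a \<open>q\<close> for which
  the average of \<open>a\<close> over \<open>[p, q)\<close> is maximal; the rest comes from the
  induction hypothesis on \<open>[q, n)\<close>. The third conjunct, a bound on the first value, is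
  the part of the invariant that shows that the values do not increase across
  \<open>q\<close>.\<close>

lemma level_sequence_exists:
  assumes "p \<le> n"
  shows "\<exists>b. level_sequence p n a b"
  using assms
proof (induction "n - p" arbitrary: p a rule: less_induct)
  case less
  show ?case
  proof (cases "p = n")
    case True
    then show ?thesis unfolding level_sequence_def by (intro exI[of _ a]) auto
  next
    case False
    with less.prems have "p < n" by simp
    define av where "av x = (\<Sum>j=p..<x. a j) / real (x - p)" for x
    have "\<exists>q\<in>{p<..n}. \<forall>x\<in>{p<..n}. av x \<le> av q"
    proof -
      have "finite (av ` {p<..n})" "av ` {p<..n} \<noteq> {}" using \<open>p < n\<close> by auto
      from Max_in[OF this] Max_ge[OF this(1)] show ?thesis by (metis imageE imageI)
    qed
    then obtain q where q: "p < q" "q \<le> n" and qmax: "\<And>x. p < x \<Longrightarrow> x \<le> n \<Longrightarrow> av x \<le> av q"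
      by auto
    define M where "M = av q"
    define a1 where "a1 = block_average p q a"
    have le: "(\<Sum>j=p..<x. a j) \<le> real (x - p) * M" if "p < x" "x \<le> n" for x
      using qmax[OF that] that by (simp add: M_def av_def[of x] pos_divide_le_eq mult.commute)
    have eq: "(\<Sum>j=p..<q. a j) = real (q - p) * M"
      using q by (simp add: M_def av_def)
    have a1_in: "a1 j = M" if "p \<le> j" "j < q" for j
      using that by (simp add: a1_def block_average_def M_def av_def)
    have a1_out: "a1 j = a j" if "j < p \<or> q \<le> j" for j
      using that by (auto simp: a1_def block_average_def)
    have "n - q < n - p" using q by simp
    \<comment> \<open>Recursing on \<open>a1\<close> instead of \<open>a\<close> puts the value
      \<open>M\<close> on \<open>[p, q)\<close> into \<open>b\<close> and lets closedness pass from
      \<open>a\<close> through one block average to \<open>b\<close>.\<close>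
    from less.hyps[OF this q(2), of a1] obtain b where b: "level_sequence q n a1 b" by blast
    note bs = b[unfolded level_sequence_def]
    have out: "b j = a1 j" if "j \<notin> {q..<n}" for j
      using bs[THEN conjunct1] that by blast
    have anti: "b j \<le> b i" if "q \<le> i" "i \<le> j" "j < n" for i j
      using bs[THEN conjunct2, THEN conjunct1] that by blast
    have bound: "b q \<le> M'"
      if "q < n" "\<And>x. q < x \<Longrightarrow> x \<le> n \<Longrightarrow> (\<Sum>j=q..<x. a1 j) \<le> real (x - q) * M'" for M'
      using bs[THEN conjunct2, THEN conjunct2, THEN conjunct1] that by blast
    have maj: "\<exists>m. q \<le> m \<and> m \<le> k \<and> (\<forall>j. m \<le> j \<longrightarrow> j \<le> k \<longrightarrow> b j = b k) \<and>
        (\<forall>w::nat \<Rightarrow> real. antimono w \<longrightarrow> (\<Sum>j=m..<n. w j * a1 j) \<le> (\<Sum>j=m..<n. w j * b j))"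
      if "q \<le> k" "k < n" for k
      using bs[THEN conjunct2, THEN conjunct2, THEN conjunct2, THEN conjunct1] that by blast
    have closed: "b \<in> S"
      if "a1 \<in> S" "\<forall>c\<in>S. \<forall>k l. k < l \<longrightarrow> l \<le> n \<longrightarrow> block_average k l c \<in> S" for S
      using bs[THEN conjunct2, THEN conjunct2, THEN conjunct2, THEN conjunct2] that by blast
    have b_in: "b j = M" if "p \<le> j" "j < q" for j
      using out[of j] a1_in[OF that] that by simp
    \<comment> \<open>After subtracting the mass of the first block, maximality of \<open>q\<close>
      bounds every average that starts at \<open>q\<close> by \<open>M\<close> too.\<close>
    have bqM: "b q \<le> M" if "q < n"
    proof (rule bound[OF that])
      fix x assume x: "q < x" "x \<le> n"
      have "(\<Sum>j=p..<x. a j) = (\<Sum>j=p..<q. a j) + (\<Sum>j=q..<x. a j)"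
        using q x by (simp add: sum.atLeastLessThan_concat)
      moreover have "(\<Sum>j=q..<x. a1 j) = (\<Sum>j=q..<x. a j)"
        by (rule sum.cong) (auto simp: a1_out)
      moreover have "(\<Sum>j=p..<x. a j) \<le> real (x - p) * M" using le q x by simp
      moreover have "real (x - p) = real (x - q) + real (q - p)" using q x by simp
      ultimately show "(\<Sum>j=q..<x. a1 j) \<le> real (x - q) * M"
        using eq by (simp add: distrib_right)
    qed
    \<comment> \<open>The majorization of the recursion at \<open>k = q\<close>, where the block
      start is forced to equal \<open>q\<close>.\<close>
    have tail: "(\<Sum>j=q..<n. w j * a j) \<le> (\<Sum>j=q..<n. w j * b j)" if "antimono w" for w
    proof (cases "q < n")
      case True
      from maj[OF order.refl this] that
      have "(\<Sum>j=q..<n. w j * a1 j) \<le> (\<Sum>j=q..<n. w j * b j)" by (metis order_antisym)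
      moreover have "(\<Sum>j=q..<n. w j * a1 j) = (\<Sum>j=q..<n. w j * a j)"
        by (rule sum.cong) (auto simp: a1_out)
      ultimately show ?thesis by simp
    qed simp
    show ?thesis
      unfolding level_sequence_def
    proof (intro exI[of _ b] conjI allI impI)
      fix j assume "j \<notin> {p..<n}" then show "b j = a j"
        using out[of j] a1_out[of j] q by auto
    next
      fix i j assume ij: "p \<le> i" "i \<le> j" "j < n"
      consider "j < q" | "i < q" "q \<le> j" | "q \<le> i" by linarith
      then show "b j \<le> b i"
      proof cases
        case 1 then show ?thesis using b_in ij by simp
      next
        case 2
        then have "b j \<le> b q" using anti ij by simp
        also have "\<dots> \<le> M" using bqM 2 ij by simp
        finally show ?thesis using b_in[of i] 2 ij by simp
      next
        case 3 then show ?thesis using anti ij by simp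
      qed
    next
      fix M' assume H: "\<forall>x. p < x \<longrightarrow> x \<le> n \<longrightarrow> (\<Sum>j=p..<x. a j) \<le> real (x - p) * M'"
      then have "real (q - p) * M \<le> real (q - p) * M'" using eq q by metis
      with q have "M \<le> M'" by simp
      then show "b p \<le> M'" using b_in[of p] q by simp
    next
      fix k assume k: "p \<le> k" "k < n"
      show "\<exists>m. p \<le> m \<and> m \<le> k \<and> (\<forall>j. m \<le> j \<longrightarrow> j \<le> k \<longrightarrow> b j = b k) \<and>
        (\<forall>w::nat \<Rightarrow> real. antimono w \<longrightarrow> (\<Sum>j=m..<n. w j * a j) \<le> (\<Sum>j=m..<n. w j * b j))"
      proof (cases "k < q")
        case True
        \<comment> \<open>The first block starts at \<open>p\<close>: Abel summation covers
          \<open>[p, q)\<close>, and \<open>tail\<close> covers \<open>[q, n)\<close>.\<close>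
        show ?thesis
        proof (intro exI[of _ p] conjI allI impI)
          fix j assume "p \<le> j" "j \<le> k" then show "b j = b k" using b_in True k by simp
        next
          fix w :: "nat \<Rightarrow> real" assume w: "antimono w"
          have "(\<Sum>j=p..<q. w j * a j) \<le> (\<Sum>j=p..<q. w j * M)"
            using weighted_sum_le_of_partial_sums_le[OF w q(1) _ eq] le q by simp
          also have "\<dots> = (\<Sum>j=p..<q. w j * b j)" by (rule sum.cong) (auto simp: b_in)
          finally show "(\<Sum>j=p..<n. w j * a j) \<le> (\<Sum>j=p..<n. w j * b j)"
            using tail[OF w] q by (simp add: sum.atLeastLessThan_concat[of p q n, symmetric])
        qed (use k in auto)
      next
        \<comment> \<open>The block start of the recursion is kept, since \<open>a\<close> and
          \<open>a1\<close> agree from \<open>q\<close> on.\<close>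
        case False
        then have "q \<le> k" by simp
        from maj[OF this k(2)] obtain m where m: "q \<le> m" "m \<le> k" "\<forall>j. m \<le> j \<longrightarrow> j \<le> k \<longrightarrow> b j = b k"
          and mw: "\<And>w::nat \<Rightarrow> real. antimono w \<Longrightarrow> (\<Sum>j=m..<n. w j * a1 j) \<le> (\<Sum>j=m..<n. w j * b j)"
          by blast
        have "(\<Sum>j=m..<n. w j * a j) \<le> (\<Sum>j=m..<n. w j * b j)" if "antimono w" for w :: "nat \<Rightarrow> real"
        proof -
          have "(\<Sum>j=m..<n. w j * a j) = (\<Sum>j=m..<n. w j * a1 j)"
            by (rule sum.cong[OF refl], subst a1_out) (use \<open>q \<le> m\<close> in auto)
          with mw[OF that] show ?thesis by simp
        qed
        moreover have "p \<le> m" using \<open>q \<le> m\<close> q(1) by simp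
        ultimately show ?thesis using m(2,3) by blast
      qed
    next
      fix S assume S: "a \<in> S" "\<forall>c\<in>S. \<forall>k l. k < l \<longrightarrow> l \<le> n \<longrightarrow> block_average k l c \<in> S"
      then have "a1 \<in> S" using q unfolding a1_def by blast
      then show "b \<in> S" using S(2) by (rule closed)
    qed
  qed
qed

section \<open>Rearrangement invariant norms\<close>

lemma sets_pos_lebesgue_iff: "A \<in> sets pos_lebesgue \<longleftrightarrow> A \<subseteq> {0<..} \<and> A \<in> sets lebesgue"
  by (subst sets_restrict_space_iff) auto

lemma emeasure_pos_lebesgue: "A \<subseteq> {0<..} \<Longrightarrow> emeasure pos_lebesgue A = emeasure lebesgue A"
  by (rule emeasure_restrict_space) auto

section \<open>Closure properties of \<open>M_plus\<close>\<close>

lemma M_plusI: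
  assumes "\<And>y. {t \<in> {0<..}. y < f t} \<in> sets lebesgue"
  shows "f \<in> M_plus"
  unfolding M_plus_def
  by (rule borel_measurableI_greater) (use assms in \<open>auto simp: sets_pos_lebesgue_iff\<close>)

lemma M_plusD:
  assumes "f \<in> M_plus"
  shows "{t \<in> {0<..}. y < f t} \<in> sets lebesgue"
proof -
  have "{t \<in> space pos_lebesgue. y < f t} \<in> sets pos_lebesgue"
    using assms unfolding M_plus_def by measurable
  then show ?thesis by (simp add: sets_pos_lebesgue_iff)
qed

text \<open>Superlevel sets of a monotone function are intervals.\<close>

lemma M_plus_antimono:
  assumes "monotone_on {0<..} (\<le>) (\<ge>) f"
  shows "f \<in> M_plus"
proof (rule M_plusI)
  fix y
  have "is_interval {t \<in> {0<..}. y < f t}"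
    unfolding is_interval_1
  proof (intro ballI allI impI)
    fix a b x
    assume "a \<in> {t \<in> {0<..}. y < f t}" "b \<in> {t \<in> {0<..}. y < f t}" and x: "a \<le> x \<and> x \<le> b"
    then have "0 < a" "0 < b" "y < f b" by auto
    moreover from this x have "f b \<le> f x" by (intro monotone_onD[OF assms]) auto
    ultimately show "x \<in> {t \<in> {0<..}. y < f t}" using x by auto
  qed
  then show "{t \<in> {0<..}. y < f t} \<in> sets lebesgue"
    using real_interval_borel_measurable by auto
qed

lemma M_plus_interval_if:
  assumes "f \<in> M_plus" "g \<in> M_plus"
  shows "(\<lambda>t. if a < t \<and> t \<le> b then f t else g t) \<in> M_plus"
proof (rule M_plusI)
  fix y
  have "{t \<in> {0<..}. y < (if a < t \<and> t \<le> b then f t else g t)} =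
      ({t \<in> {0<..}. y < f t} \<inter> {a<..b}) \<union> ({t \<in> {0<..}. y < g t} - {a<..b})"
    by auto
  also have "\<dots> \<in> sets lebesgue"
    by (intro sets.Un sets.Int sets.Diff M_plusD assms) simp_all
  finally show "{t \<in> {0<..}. y < (if a < t \<and> t \<le> b then f t else g t)} \<in> sets lebesgue" .
qed

lemma M_plus_const [simp]: "(\<lambda>t. c) \<in> M_plus"
  by (simp add: M_plus_def)

lemma M_plus_cmult: "f \<in> M_plus \<Longrightarrow> (\<lambda>t. c * f t) \<in> M_plus"
  unfolding M_plus_def by measurable

lemma M_plus_add: "f \<in> M_plus \<Longrightarrow> g \<in> M_plus \<Longrightarrow> (\<lambda>t. f t + g t) \<in> M_plus"
  unfolding M_plus_def by measurable

lemma M_plus_sum: "(\<And>i. i \<in> A \<Longrightarrow> f i \<in> M_plus) \<Longrightarrow> (\<lambda>t. \<Sum>i\<in>A. f i t) \<in> M_plus"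
  unfolding M_plus_def by measurable

section \<open>The axioms of a rearrangement invariant norm as rules\<close>

context
  fixes N
  assumes N: "rearrangement_invariant_norm N"
begin

lemmas norm_axioms = N[unfolded rearrangement_invariant_norm_def banach_function_norm_def]

lemma norm_cmult: "f \<in> M_plus \<Longrightarrow> a \<ge> 0 \<Longrightarrow> N (\<lambda>t. ennreal a * f t) = ennreal a * N f"
  using norm_axioms[THEN conjunct1, THEN conjunct1] by blast

lemma norm_add_le: "f \<in> M_plus \<Longrightarrow> g \<in> M_plus \<Longrightarrow> N (\<lambda>t. f t + g t) \<le> N f + N g"
  using norm_axioms[THEN conjunct1, THEN conjunct2, THEN conjunct1] by blast

lemma norm_eq_0_iff: "f \<in> M_plus \<Longrightarrow> N f = 0 \<longleftrightarrow> (AE t in pos_lebesgue. f t = 0)"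
  using norm_axioms[THEN conjunct1, THEN conjunct2, THEN conjunct2, THEN conjunct1] by blast

lemma norm_mono:
  assumes "f \<in> M_plus" "g \<in> M_plus" "\<And>t. 0 < t \<Longrightarrow> f t \<le> g t"
  shows "N f \<le> N g"
proof -
  have "AE t in pos_lebesgue. f t \<le> g t" by (rule AE_I2) (use assms in auto)
  with norm_axioms[THEN conjunct1, THEN conjunct2, THEN conjunct2, THEN conjunct2, THEN conjunct1] assms(1,2) show ?thesis by blast
qed

lemma norm_tendsto:
  assumes "\<And>n. F n \<in> M_plus" "f \<in> M_plus"
    "\<And>t. 0 < t \<Longrightarrow> incseq (\<lambda>n. F n t)" "\<And>t. 0 < t \<Longrightarrow> (\<lambda>n. F n t) \<longlonglongrightarrow> f t"
  shows "(\<lambda>n. N (F n)) \<longlonglongrightarrow> N f"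
proof -
  have "AE t in pos_lebesgue. incseq (\<lambda>n. F n t) \<and> (\<lambda>n. F n t) \<longlonglongrightarrow> f t"
    by (rule AE_I2) (use assms in auto)
  with norm_axioms[THEN conjunct1, THEN conjunct2, THEN conjunct2, THEN conjunct2, THEN conjunct2, THEN conjunct1] assms(1,2) show ?thesis by blast
qed

lemma norm_indicator_finite:
  "E \<in> sets pos_lebesgue \<Longrightarrow> emeasure pos_lebesgue E < \<infinity> \<Longrightarrow> N (indicator E) < \<infinity>"
  using norm_axioms[THEN conjunct1, THEN conjunct2, THEN conjunct2, THEN conjunct2, THEN conjunct2, THEN conjunct2, THEN conjunct1] by blast

lemma norm_integral_bound:
  assumes "E \<in> sets pos_lebesgue" "emeasure pos_lebesgue E < \<infinity>"
  obtains C :: real where "\<And>f. f \<in> M_plus \<Longrightarrow> (\<integral>\<^sup>+t\<in>E. f t \<partial>pos_lebesgue) \<le> ennreal C * N f"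
proof -
  have "\<exists>C::real. \<forall>f\<in>M_plus. (\<integral>\<^sup>+t\<in>E. f t \<partial>pos_lebesgue) \<le> ennreal C * N f"
    using norm_axioms[THEN conjunct1, THEN conjunct2, THEN conjunct2, THEN conjunct2, THEN conjunct2, THEN conjunct2, THEN conjunct2] assms by blast
  with that show ?thesis by blast
qed

lemma norm_equimeasurable:
  assumes "f \<in> M_plus" "g \<in> M_plus"
    "\<And>s. 0 \<le> s \<Longrightarrow> emeasure lebesgue {t \<in> {0<..}. ennreal s < f t} = emeasure lebesgue {t \<in> {0<..}. ennreal s < g t}"
  shows "N f = N g"
proof -
  have "equimeasurable f g"
    unfolding equimeasurable_def distribution_function_def using assms(3)
    by (subst (1 2) emeasure_pos_lebesgue) auto
  with norm_axioms[THEN conjunct2] assms(1,2) show ?thesis by blast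
qed

lemma norm_0: "N (\<lambda>t. 0) = 0"
  by (subst norm_eq_0_iff) auto

lemma norm_sum_le:
  assumes "finite A" "\<And>i. i \<in> A \<Longrightarrow> F i \<in> M_plus"
  shows "N (\<lambda>t. \<Sum>i\<in>A. F i t) \<le> (\<Sum>i\<in>A. N (F i))"
  using assms
proof (induction A rule: finite_induct)
  case (insert x A)
  have "N (\<lambda>t. F x t + (\<Sum>i\<in>A. F i t)) \<le> N (F x) + N (\<lambda>t. \<Sum>i\<in>A. F i t)"
    using insert.prems by (intro norm_add_le M_plus_sum) auto
  also have "\<dots> \<le> N (F x) + (\<Sum>i\<in>A. N (F i))" using insert by (intro add_left_mono) auto
  finally show ?case using insert by simp
qed (simp add: norm_0)

end

text \<open>Fubini for the region \<open>0 \<le> s < f x\<close>: its slice over \<open>x\<close>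
  has length \<open>f x\<close>, also when this is infinite, and its slice at height
  \<open>s\<close> is a superlevel set.\<close>

lemma nn_integral_layer_cake:
  assumes "sigma_finite_measure M" and [measurable]: "f \<in> borel_measurable M"
  shows "(\<integral>\<^sup>+x. f x \<partial>M) = (\<integral>\<^sup>+s. emeasure M {x \<in> space M. ennreal s < f x} * indicator {0..} s \<partial>lborel)"
proof -
  interpret sigma_finite_measure M by fact
  interpret pair_sigma_finite M lborel ..
  have len: "(\<integral>\<^sup>+s. indicator {0..} s * indicator {s. ennreal s < y} s \<partial>lborel) = y" for y :: ennreal
  proof -
    have "(\<integral>\<^sup>+s. indicator {0..} s * indicator {s. ennreal s < y} s \<partial>lborel) =
      (\<integral>\<^sup>+s. indicator {s. 0 \<le> s \<and> ennreal s < y} s \<partial>lborel)"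
      by (rule nn_integral_cong) (auto split: split_indicator)
    also have "\<dots> = emeasure lborel {s. 0 \<le> s \<and> ennreal s < y}"
      by (subst nn_integral_indicator) auto
    also have "\<dots> = y"
    proof (cases y)
      case (real r)
      then have "{s. 0 \<le> s \<and> ennreal s < y} = {0..<r}" by (auto simp: ennreal_less_iff)
      with real show ?thesis by simp
    next
      case top
      then have "{s. 0 \<le> s \<and> ennreal s < y} = {0..}" by auto
      moreover have "emeasure lborel {0::real..} = top"
      proof (rule ccontr)
        assume "emeasure lborel {0::real..} \<noteq> top"
        then obtain n :: nat where "emeasure lborel {0::real..} < of_nat n"
          using ennreal_Ex_less_of_nat by (auto simp: less_top)
        moreover have "emeasure lborel {0..<real n} \<le> emeasure lborel {0::real..}"
          by (rule emeasure_mono) auto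
        ultimately show False by (simp add: ennreal_of_nat_eq_real_of_nat)
      qed
      ultimately show ?thesis using top by simp
    qed
    finally show ?thesis .
  qed
  have "(\<integral>\<^sup>+x. f x \<partial>M) = (\<integral>\<^sup>+x. \<integral>\<^sup>+s. indicator {0..} s * indicator {s. ennreal s < f x} s \<partial>lborel \<partial>M)"
    by (simp add: len)
  also have "\<dots> = (\<integral>\<^sup>+s. \<integral>\<^sup>+x. indicator {0..} s * indicator {s. ennreal s < f x} s \<partial>M \<partial>lborel)"
    by (rule Fubini'[symmetric]) (simp add: indicator_def of_bool_def, measurable)
  also have "\<dots> = (\<integral>\<^sup>+s. emeasure M {x \<in> space M. ennreal s < f x} * indicator {0..} s \<partial>lborel)"
  proof (rule nn_integral_cong)
    fix s :: real
    have "(\<integral>\<^sup>+x. indicator {0..} s * indicator {s. ennreal s < f x} s \<partial>M) =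
      (\<integral>\<^sup>+x. indicator {0..} s * indicator {x \<in> space M. ennreal s < f x} x \<partial>M)"
      by (rule nn_integral_cong) (auto split: split_indicator)
    also have "\<dots> = emeasure M {x \<in> space M. ennreal s < f x} * indicator {0..} s"
      by (subst nn_integral_cmult) (simp_all add: mult.commute)
    finally show "(\<integral>\<^sup>+x. indicator {0..} s * indicator {s. ennreal s < f x} s \<partial>M) =
      emeasure M {x \<in> space M. ennreal s < f x} * indicator {0..} s" .
  qed
  finally show ?thesis .
qed

section \<open>Functions that are constant on cells\<close>

lemma sets_pos_lebesgue_Ioc [simp]: "0 \<le> a \<Longrightarrow> {a<..b} \<in> sets pos_lebesgue"
  by (auto simp: sets_pos_lebesgue_iff)

lemma emeasure_pos_lebesgue_Ioc [simp]:
  "0 \<le> a \<Longrightarrow> a \<le> b \<Longrightarrow> emeasure pos_lebesgue {a<..b} = ennreal (b - a)"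
  by (subst emeasure_pos_lebesgue) auto

lemma measurable_times_indicator_Ioc:
  "f \<in> M_plus \<Longrightarrow> 0 \<le> a \<Longrightarrow> (\<lambda>t. f t * indicator {a<..b} t) \<in> borel_measurable pos_lebesgue"
  unfolding M_plus_def by (intro borel_measurable_times_ennreal borel_measurable_indicator) auto

lemma emeasure_split_Ioc:
  fixes a b :: real
  assumes "A \<in> sets lebesgue"
  shows "emeasure lebesgue A = emeasure lebesgue (A - {a<..b}) + emeasure lebesgue (A \<inter> {a<..b})"
proof -
  have "emeasure lebesgue (A - {a<..b}) + emeasure lebesgue (A \<inter> {a<..b}) =
    emeasure lebesgue ((A - {a<..b}) \<union> (A \<inter> {a<..b}))"
    by (rule plus_emeasure) (use assms in \<open>auto intro!: sets.Diff sets.Int\<close>)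
  also have "(A - {a<..b}) \<union> (A \<inter> {a<..b}) = A" by blast
  finally show ?thesis by simp
qed

section \<open>Cells of length \<open>\<delta>\<close>\<close>

text \<open>The index \<open>p\<close> of the cell \<open>(p\<delta>, (p + 1)\<delta>]\<close> that contains \<open>t > 0\<close>.\<close>

definition cell :: "real \<Rightarrow> real \<Rightarrow> nat" where
  "cell \<delta> t = nat (\<lceil>t / \<delta>\<rceil> - 1)"

lemma cell_eq_iff:
  assumes "0 < \<delta>" "0 < t"
  shows "cell \<delta> t = p \<longleftrightarrow> real p * \<delta> < t \<and> t \<le> (real p + 1) * \<delta>"
proof -
  have "0 < \<lceil>t / \<delta>\<rceil>" using assms by simp
  then have "cell \<delta> t = p \<longleftrightarrow> \<lceil>t / \<delta>\<rceil> = int p + 1"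
    unfolding cell_def by linarith
  also have "\<dots> \<longleftrightarrow> real p < t / \<delta> \<and> t / \<delta> \<le> real p + 1"
    by (simp add: ceiling_eq_iff)
  also have "\<dots> \<longleftrightarrow> real p * \<delta> < t \<and> t \<le> (real p + 1) * \<delta>"
    using assms by (simp add: pos_less_divide_eq pos_divide_le_eq)
  finally show ?thesis .
qed

lemma cell_bounds:
  assumes "0 < \<delta>" "0 < t"
  shows "real (cell \<delta> t) * \<delta> < t" "t \<le> (real (cell \<delta> t) + 1) * \<delta>"
  using cell_eq_iff[OF assms] by blast+

lemma cell_less_iff:
  assumes "0 < \<delta>" "0 < t"
  shows "cell \<delta> t < n \<longleftrightarrow> t \<le> real n * \<delta>"
proof
  assume "cell \<delta> t < n"
  then have "real (cell \<delta> t) + 1 \<le> real n" by linarith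
  then have "(real (cell \<delta> t) + 1) * \<delta> \<le> real n * \<delta>" using assms by (intro mult_right_mono) auto
  with cell_bounds(2)[OF assms] show "t \<le> real n * \<delta>" by linarith
next
  assume "t \<le> real n * \<delta>"
  with cell_bounds(1)[OF assms] have "real (cell \<delta> t) * \<delta> < real n * \<delta>" by linarith
  with assms show "cell \<delta> t < n" by simp
qed

lemma cell_mono:
  assumes "0 < \<delta>" "0 < s" "s \<le> t"
  shows "cell \<delta> s \<le> cell \<delta> t"
proof -
  have "s \<le> real (Suc (cell \<delta> t)) * \<delta>"
    using cell_bounds(2)[of \<delta> t] assms by (simp add: add.commute)
  then have "cell \<delta> s < Suc (cell \<delta> t)" by (subst cell_less_iff) (use assms in auto)
  then show ?thesis by simp
qed

lemma nn_integral_cells: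
  assumes "f \<in> M_plus" "0 \<le> a" "0 < \<delta>" "k \<le> l"
  shows "(\<integral>\<^sup>+t\<in>{a + real k * \<delta><..a + real l * \<delta>}. f t \<partial>pos_lebesgue) =
    (\<Sum>p=k..<l. \<integral>\<^sup>+t\<in>{a + real p * \<delta><..a + (real p + 1) * \<delta>}. f t \<partial>pos_lebesgue)"
  using assms(4)
proof (induction l rule: dec_induct)
  case (step l)
  define u w z where "u = a + real k * \<delta>" and "w = a + real l * \<delta>" and "z = a + (real l + 1) * \<delta>"
  have "0 \<le> u" "u \<le> w" "w \<le> z"
    using step assms by (auto simp: u_def w_def z_def intro!: mult_right_mono)
  have "(\<integral>\<^sup>+t\<in>{u<..z}. f t \<partial>pos_lebesgue) =
    (\<integral>\<^sup>+t. f t * indicator {u<..w} t + f t * indicator {w<..z} t \<partial>pos_lebesgue)"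
    by (rule nn_integral_cong) (use \<open>u \<le> w\<close> \<open>w \<le> z\<close> in \<open>auto split: split_indicator\<close>)
  also have "\<dots> = (\<integral>\<^sup>+t\<in>{u<..w}. f t \<partial>pos_lebesgue) + (\<integral>\<^sup>+t\<in>{w<..z}. f t \<partial>pos_lebesgue)"
    by (rule nn_integral_add)
      (use assms \<open>0 \<le> u\<close> \<open>u \<le> w\<close> in \<open>auto intro!: measurable_times_indicator_Ioc\<close>)
  finally show ?case
    using step by (simp add: u_def w_def z_def sum.atLeastLessThan_Suc add.commute[of 1])
qed simp

text \<open>Keeping \<open>f\<close> outside the interval lets averaging be done on one interval at
  a time, without splitting the norm.\<close>

definition replace_cells ::
  "(real \<Rightarrow> ennreal) \<Rightarrow> real \<Rightarrow> real \<Rightarrow> nat \<Rightarrow> (nat \<Rightarrow> ennreal) \<Rightarrow> real \<Rightarrow> ennreal" where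
  "replace_cells f a \<delta> n v t =
     (if a < t \<and> t \<le> a + real n * \<delta> then v (cell \<delta> (t - a)) else f t)"

lemma replace_cells_level_set:
  assumes "0 \<le> a" "0 < \<delta>"
  shows "{t \<in> {0<..}. y < replace_cells f a \<delta> n v t} =
    ({t \<in> {0<..}. y < f t} - {a<..a + real n * \<delta>}) \<union>
    (\<Union>p\<in>{p \<in> {..<n}. y < v p}. {a + real p * \<delta><..a + (real p + 1) * \<delta>})"
    (is "?L = ?R")
proof (rule set_eqI)
  fix t
  show "t \<in> ?L \<longleftrightarrow> t \<in> ?R"
  proof (cases "a < t \<and> t \<le> a + real n * \<delta>")
    case True
    then have pos: "0 < t - a" by simp
    have "cell \<delta> (t - a) < n" using cell_less_iff[OF assms(2) pos] True by simp
    moreover have "t \<in> {a + real p * \<delta><..a + (real p + 1) * \<delta>} \<longleftrightarrow> cell \<delta> (t - a) = p" for p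
      unfolding cell_eq_iff[OF assms(2) pos] greaterThanAtMost_iff by (safe; linarith)
    ultimately show ?thesis using True assms by (auto simp: replace_cells_def)
  next
    case False
    have "t \<notin> {a + real p * \<delta><..a + (real p + 1) * \<delta>}" if "p < n" for p
    proof -
      have "(real p + 1) * \<delta> \<le> real n * \<delta>" "0 \<le> real p * \<delta>"
        using that assms by (auto intro!: mult_right_mono)
      with False show ?thesis by auto
    qed
    with False show ?thesis by (auto simp: replace_cells_def)
  qed
qed

lemma M_plus_replace_cells:
  assumes "f \<in> M_plus" "0 \<le> a" "0 < \<delta>"
  shows "replace_cells f a \<delta> n v \<in> M_plus"
proof (rule M_plusI)
  fix y
  show "{t \<in> {0<..}. y < replace_cells f a \<delta> n v t} \<in> sets lebesgue"
    unfolding replace_cells_level_set[OF assms(2,3)]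
    by (intro sets.Un sets.Diff sets.finite_UN M_plusD assms(1)) auto
qed

text \<open>The measure depends on \<open>v\<close> only through the number of cells with value
  above \<open>y\<close>, so it does not change when the cell values are permuted.\<close>

lemma emeasure_replace_cells:
  assumes "f \<in> M_plus" "0 \<le> a" "0 < \<delta>"
  shows "emeasure lebesgue {t \<in> {0<..}. y < replace_cells f a \<delta> n v t} =
    emeasure lebesgue ({t \<in> {0<..}. y < f t} - {a<..a + real n * \<delta>}) +
    of_nat (card {p \<in> {..<n}. y < v p}) * ennreal \<delta>"
proof -
  let ?J = "\<lambda>p. {a + real p * \<delta><..a + (real p + 1) * \<delta>}"
  let ?A = "{p \<in> {..<n}. y < v p}"
  have J: "?J p \<subseteq> {a<..a + real n * \<delta>}" if "p < n" for p
  proof -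
    have "(real p + 1) * \<delta> \<le> real n * \<delta>" "0 \<le> real p * \<delta>"
      using that assms by (auto intro!: mult_right_mono)
    then show ?thesis by auto
  qed
  have disj: "disjoint_family_on ?J ?A"
    unfolding disjoint_family_on_def
  proof (intro ballI impI)
    fix p q :: nat assume "p \<noteq> q"
    moreover have False if "t \<in> ?J p" "t \<in> ?J q" "p < q" for p q :: nat and t
    proof -
      have "(real p + 1) * \<delta> \<le> real q * \<delta>" using that assms by (auto intro!: mult_right_mono)
      with that show False by auto
    qed
    ultimately show "?J p \<inter> ?J q = {}" by (metis disjoint_iff linorder_neqE_nat)
  qed
  have "emeasure lebesgue (\<Union>p\<in>?A. ?J p) = (\<Sum>p\<in>?A. emeasure lebesgue (?J p))"
    by (rule sum_emeasure[symmetric]) (use disj in auto)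
  also have "\<dots> = (\<Sum>p\<in>?A. ennreal \<delta>)"
    by (rule sum.cong) (use assms in \<open>auto simp: algebra_simps\<close>)
  also have "\<dots> = of_nat (card ?A) * ennreal \<delta>" by simp
  finally have U: "emeasure lebesgue (\<Union>p\<in>?A. ?J p) = of_nat (card ?A) * ennreal \<delta>" .
  show ?thesis
    unfolding replace_cells_level_set[OF assms(2,3)] U[symmetric]
    by (rule plus_emeasure[symmetric])
      (use J M_plusD[OF assms(1), of y] in \<open>auto intro!: sets.Diff sets.finite_UN\<close>)
qed

text \<open>Injective because \<open>n\<close> would divide a difference smaller than
  \<open>n\<close>; surjective because the set is finite.\<close>

lemma bij_betw_add_mod:
  fixes n r :: nat
  shows "bij_betw (\<lambda>p. (p + r) mod n) {..<n} {..<n}"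
proof (cases "n = 0")
  case False
  have "inj_on (\<lambda>p. (p + r) mod n) {..<n}"
  proof (rule inj_onI)
    have *: "q = p" if "p \<le> q" "q < n" "(q + r) mod n = (p + r) mod n" for p q
    proof -
      have "n dvd (q + r) - (p + r)" using mod_eq_dvd_iff_nat[of "p + r" "q + r" n] that by simp
      then have "n dvd q - p" by simp
      with that show ?thesis by (auto dest!: dvd_imp_le)
    qed
    fix p q assume "p \<in> {..<n}" "q \<in> {..<n}" "(p + r) mod n = (q + r) mod n"
    then have "p < n" "q < n" "(p + r) mod n = (q + r) mod n" by auto
    then show "p = q" by (metis * nat_le_linear)
  qed
  moreover have "(\<lambda>p. (p + r) mod n) ` {..<n} \<subseteq> {..<n}" using False by auto
  ultimately show ?thesis
    by (simp add: bij_betw_def endo_inj_surj)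
qed (simp add: bij_betw_def)

text \<open>The \<open>n\<close> cyclic rotations of the cell values are equimeasurable, and their
  mean takes the average value on every cell and equals \<open>f\<close> outside. Subadditivity and
  homogeneity bound the norm of this mean.\<close>

lemma norm_replace_cells_average_le:
  assumes N: "rearrangement_invariant_norm N"
    and f: "f \<in> M_plus" "0 \<le> a" "0 < \<delta>" and "0 < n"
  shows "N (replace_cells f a \<delta> n (\<lambda>_. ennreal (1 / real n) * (\<Sum>p<n. v p))) \<le> N (replace_cells f a \<delta> n v)"
proof -
  define F where "F r = replace_cells f a \<delta> n (\<lambda>p. v ((p + r) mod n))" for r
  have F: "F r \<in> M_plus" for r unfolding F_def by (rule M_plus_replace_cells[OF f])
  have NF: "N (F r) = N (replace_cells f a \<delta> n v)" for r
  proof (rule norm_equimeasurable[OF N F M_plus_replace_cells[OF f]])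
    fix s :: real
    have card: "card {p \<in> {..<n}. P p} = (\<Sum>p<n. if P p then 1 else 0)" for P
      unfolding card_eq_sum by (rule sum.inter_filter) simp
    have "card {p \<in> {..<n}. ennreal s < v ((p + r) mod n)} = card {p \<in> {..<n}. ennreal s < v p}"
      unfolding card
      using sum.reindex_bij_betw[OF bij_betw_add_mod[of r n], of "\<lambda>p. if ennreal s < v p then 1 else 0"] .
    then show "emeasure lebesgue {t \<in> {0<..}. ennreal s < F r t} =
      emeasure lebesgue {t \<in> {0<..}. ennreal s < replace_cells f a \<delta> n v t}"
      unfolding F_def emeasure_replace_cells[OF f] by simp
  qed
  have inv: "ennreal (1 / real n) * (of_nat n * y) = y" for y
  proof -
    have "ennreal (1 / real n) * of_nat n = 1"
      using \<open>0 < n\<close> by (simp add: ennreal_of_nat_eq_real_of_nat flip: ennreal_mult)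
    then show ?thesis by (simp add: mult.assoc[symmetric])
  qed
  have "replace_cells f a \<delta> n (\<lambda>_. ennreal (1 / real n) * (\<Sum>p<n. v p)) t =
    ennreal (1 / real n) * (\<Sum>r<n. F r t)" for t
  proof (cases "a < t \<and> t \<le> a + real n * \<delta>")
    case True
    \<comment> \<open>On a fixed cell the rotations \<open>r\<close> run through every value of
      \<open>v\<close> exactly once.\<close>
    have "(\<Sum>r<n. v ((cell \<delta> (t - a) + r) mod n)) = (\<Sum>p<n. v p)"
      using sum.reindex_bij_betw[OF bij_betw_add_mod[of "cell \<delta> (t - a)" n], of v]
      by (simp add: add.commute)
    with True show ?thesis by (simp add: F_def replace_cells_def)
  next
    case False
    then show ?thesis by (auto simp: F_def replace_cells_def inv)
  qed
  then have "N (replace_cells f a \<delta> n (\<lambda>_. ennreal (1 / real n) * (\<Sum>p<n. v p))) =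
    N (\<lambda>t. ennreal (1 / real n) * (\<Sum>r<n. F r t))" by presburger
  also have "\<dots> = ennreal (1 / real n) * N (\<lambda>t. \<Sum>r<n. F r t)"
    by (rule norm_cmult[OF N M_plus_sum]) (use F in auto)
  also have "\<dots> \<le> ennreal (1 / real n) * (\<Sum>r<n. N (F r))"
    by (intro mult_left_mono norm_sum_le[OF N]) (use F in auto)
  also have "\<dots> = N (replace_cells f a \<delta> n v)" by (simp add: NF inv)
  finally show ?thesis .
qed

section \<open>Decreasing rearrangement on an interval\<close>

text \<open>The distribution function of \<open>f\<close> restricted to \<open>(a, b]\<close>,
  real-valued because the interval is bounded.\<close>

definition level_measure :: "(real \<Rightarrow> ennreal) \<Rightarrow> real \<Rightarrow> real \<Rightarrow> real \<Rightarrow> real" where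
  "level_measure f a b s = measure lebesgue ({t \<in> {0<..}. ennreal s < f t} \<inter> {a<..b})"

text \<open>The decreasing rearrangement of that restriction as the generalized inverse of
  \<open>level_measure\<close>. The argument \<open>u\<close> is the distance from \<open>a\<close>,
  and an empty supremum is 0.\<close>

definition interval_rearrangement :: "(real \<Rightarrow> ennreal) \<Rightarrow> real \<Rightarrow> real \<Rightarrow> real \<Rightarrow> ennreal" where
  "interval_rearrangement f a b u = (SUP s\<in>{s. 0 \<le> s \<and> u < level_measure f a b s}. ennreal s)"

section \<open>The distribution function on an interval\<close>

lemma level_set_fmeasurable:
  fixes a b :: real
  assumes "f \<in> M_plus"
  shows "{t \<in> {0<..}. y < f t} \<inter> {a<..b} \<in> lmeasurable"
proof (rule bounded_set_imp_lmeasurable)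
  show "bounded ({t \<in> {0<..}. y < f t} \<inter> {a<..b})" by (simp add: bounded_Int)
  show "{t \<in> {0<..}. y < f t} \<inter> {a<..b} \<in> sets lebesgue"
    by (intro sets.Int M_plusD assms) simp
qed

lemma emeasure_level_set:
  assumes "f \<in> M_plus"
  shows "emeasure lebesgue ({t \<in> {0<..}. ennreal s < f t} \<inter> {a<..b}) = ennreal (level_measure f a b s)"
  unfolding level_measure_def
  by (rule emeasure_eq_measure2[OF level_set_fmeasurable[OF assms]])

lemma level_measure_bounds:
  assumes "f \<in> M_plus" "a \<le> b"
  shows "0 \<le> level_measure f a b s" "level_measure f a b s \<le> b - a"
proof -
  have "measure lebesgue ({t \<in> {0<..}. ennreal s < f t} \<inter> {a<..b}) \<le> measure lebesgue {a<..b}"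
    by (rule measure_mono_fmeasurable)
      (use M_plusD[OF assms(1)] in \<open>auto intro!: bounded_set_imp_lmeasurable\<close>)
  then show "level_measure f a b s \<le> b - a" using assms by (simp add: level_measure_def)
qed (simp add: level_measure_def)

lemma level_measure_antimono:
  assumes "f \<in> M_plus" "s \<le> s'"
  shows "level_measure f a b s' \<le> level_measure f a b s"
  unfolding level_measure_def
proof (rule measure_mono_fmeasurable)
  have "ennreal s \<le> ennreal s'" using assms by (simp add: ennreal_leI)
  then show "{t \<in> {0<..}. ennreal s' < f t} \<inter> {a<..b} \<subseteq> {t \<in> {0<..}. ennreal s < f t} \<inter> {a<..b}"
    by auto
qed (use level_set_fmeasurable[OF assms(1)] in auto)

text \<open>The superlevel sets at heights \<open>s + 1 / Suc n\<close> increase to the one at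
  \<open>s\<close>, so continuity from below preserves the strict inequality at some larger
  height.\<close>

lemma level_measure_right_continuous:
  assumes f: "f \<in> M_plus" and s: "0 \<le> s" and u: "u < level_measure f a b s"
  obtains s' where "s < s'" "u < level_measure f a b s'"
proof -
  define A where "A n = {t \<in> {0<..}. ennreal (s + 1 / real (Suc n)) < f t} \<inter> {a<..b}" for n
  have un: "(\<Union>n. A n) = {t \<in> {0<..}. ennreal s < f t} \<inter> {a<..b}"
  proof (intro equalityI subsetI)
    fix t assume "t \<in> (\<Union>n. A n)"
    then obtain n where "t \<in> A n" by blast
    moreover have "ennreal s \<le> ennreal (s + 1 / real (Suc n))" by (rule ennreal_leI) simp
    ultimately show "t \<in> {t \<in> {0<..}. ennreal s < f t} \<inter> {a<..b}" unfolding A_def by auto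
  next
    fix t assume t: "t \<in> {t \<in> {0<..}. ennreal s < f t} \<inter> {a<..b}"
    then obtain y where y: "ennreal s < y" "y < f t" using dense by blast
    then obtain r where r: "y = ennreal r" "0 \<le> r" by (cases y) auto
    with y s have "s < r" by (simp add: ennreal_less_iff)
    then obtain n where "inverse (real (Suc n)) < r - s"
      using reals_Archimedean[of "r - s"] by auto
    then have "ennreal (s + 1 / real (Suc n)) \<le> y"
      unfolding r by (intro ennreal_leI) (simp add: inverse_eq_divide)
    with y t show "t \<in> (\<Union>n. A n)" unfolding A_def by (auto intro: le_less_trans)
  qed
  have "incseq A"
    unfolding A_def
  proof (intro monoI subsetI)
    fix m n :: nat and t
    assume mn: "m \<le> n" and t: "t \<in> {t \<in> {0<..}. ennreal (s + 1 / real (Suc m)) < f t} \<inter> {a<..b}"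
    have "ennreal (s + 1 / real (Suc n)) \<le> ennreal (s + 1 / real (Suc m))"
      using mn by (intro ennreal_leI add_left_mono divide_left_mono) auto
    with t show "t \<in> {t \<in> {0<..}. ennreal (s + 1 / real (Suc n)) < f t} \<inter> {a<..b}"
      by (auto intro: le_less_trans)
  qed
  moreover have "range A \<subseteq> sets lebesgue"
    using level_set_fmeasurable[OF f] unfolding A_def by (auto intro: fmeasurableD)
  moreover have "emeasure lebesgue (\<Union>n. A n) \<noteq> \<infinity>"
    unfolding un emeasure_level_set[OF f] by simp
  ultimately have "(\<lambda>n. measure lebesgue (A n)) \<longlonglongrightarrow> measure lebesgue (\<Union>n. A n)"
    by (intro Lim_measure_incseq)
  then have "(\<lambda>n. level_measure f a b (s + 1 / real (Suc n))) \<longlonglongrightarrow> level_measure f a b s"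
    unfolding un unfolding A_def level_measure_def .
  from order_tendstoD(1)[OF this u] obtain n where "u < level_measure f a b (s + 1 / real (Suc n))"
    by (auto simp: eventually_sequentially)
  with that[of "s + 1 / real (Suc n)"] show thesis by simp
qed

text \<open>From left to right this is monotonicity of \<open>level_measure\<close>. The converse
  uses right continuity, since the supremum has to exceed \<open>s\<close> strictly.\<close>

lemma less_interval_rearrangement_iff:
  assumes "f \<in> M_plus" "0 \<le> s"
  shows "ennreal s < interval_rearrangement f a b u \<longleftrightarrow> u < level_measure f a b s"
proof
  assume "ennreal s < interval_rearrangement f a b u"
  then obtain s' where "0 \<le> s'" "u < level_measure f a b s'" "ennreal s < ennreal s'"
    unfolding interval_rearrangement_def by (auto simp: less_SUP_iff)
  then show "u < level_measure f a b s"
    using level_measure_antimono[OF assms(1), of s s' a b] assms(2) by (auto simp: ennreal_less_iff)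
next
  assume "u < level_measure f a b s"
  from level_measure_right_continuous[OF assms this] obtain s'
    where "s < s'" "u < level_measure f a b s'" by blast
  then show "ennreal s < interval_rearrangement f a b u"
    unfolding interval_rearrangement_def less_SUP_iff
    by (intro bexI[of _ s']) (use assms in \<open>auto simp: ennreal_less_iff\<close>)
qed

lemma interval_rearrangement_antimono: "u \<le> v \<Longrightarrow> interval_rearrangement f a b v \<le> interval_rearrangement f a b u"
  unfolding interval_rearrangement_def by (rule SUP_subset_mono) auto

section \<open>Rearranging inside an interval\<close>

definition rearrange_on :: "(real \<Rightarrow> ennreal) \<Rightarrow> real \<Rightarrow> real \<Rightarrow> real \<Rightarrow> ennreal" where
  "rearrange_on f a b t = (if a < t \<and> t \<le> b then interval_rearrangement f a b (t - a) else f t)"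

lemma M_plus_rearrange_on:
  assumes "f \<in> M_plus"
  shows "rearrange_on f a b \<in> M_plus"
proof -
  have "(\<lambda>t. interval_rearrangement f a b (t - a)) \<in> M_plus"
    by (rule M_plus_antimono) (auto intro!: monotone_onI interval_rearrangement_antimono)
  then show ?thesis
    unfolding rearrange_on_def[abs_def] by (rule M_plus_interval_if) (rule assms)
qed

lemma rearrange_on_level_set:
  assumes "f \<in> M_plus" "0 \<le> a" "a < b" "0 \<le> s"
  shows "{t \<in> {0<..}. ennreal s < rearrange_on f a b t} \<inter> {a<..b} = {a<..<a + level_measure f a b s}"
proof -
  have "a + level_measure f a b s \<le> b"
    using level_measure_bounds(2)[OF assms(1), of a b s] assms(3) by simp
  moreover have "ennreal s < rearrange_on f a b t \<longleftrightarrow> t - a < level_measure f a b s" if "t \<in> {a<..b}" for t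
    using that less_interval_rearrangement_iff[OF assms(1,4)] by (simp add: rearrange_on_def)
  ultimately show ?thesis using assms(2) by fastforce
qed

lemma emeasure_rearrange_on_level_set:
  assumes "f \<in> M_plus" "0 \<le> a" "a < b" "0 \<le> s"
  shows "emeasure lebesgue ({t \<in> {0<..}. ennreal s < rearrange_on f a b t} \<inter> {a<..b}) =
    emeasure lebesgue ({t \<in> {0<..}. ennreal s < f t} \<inter> {a<..b})"
  unfolding rearrange_on_level_set[OF assms] emeasure_level_set[OF assms(1)]
  using level_measure_bounds[OF assms(1), of a b s] assms by simp

text \<open>Superlevel sets keep their measure inside \<open>(a, b]\<close> and do not move outside,
  so the two functions are equimeasurable on the whole half-line.\<close>

lemma norm_rearrange_on:
  assumes N: "rearrangement_invariant_norm N" and f: "f \<in> M_plus" "0 \<le> a" "a < b"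
  shows "N (rearrange_on f a b) = N f"
proof (rule norm_equimeasurable[OF N M_plus_rearrange_on[OF f(1)] f(1)])
  fix s :: real assume s: "0 \<le> s"
  have "{t \<in> {0<..}. ennreal s < rearrange_on f a b t} - {a<..b} = {t \<in> {0<..}. ennreal s < f t} - {a<..b}"
    by (auto simp: rearrange_on_def)
  with emeasure_rearrange_on_level_set[OF f s]
  show "emeasure lebesgue {t \<in> {0<..}. ennreal s < rearrange_on f a b t} =
    emeasure lebesgue {t \<in> {0<..}. ennreal s < f t}"
    using emeasure_split_Ioc[OF M_plusD[OF M_plus_rearrange_on[OF f(1)]], of "ennreal s" a b a b]
      emeasure_split_Ioc[OF M_plusD[OF f(1)], of "ennreal s" a b] by simp
qed

section \<open>Integrals determined by level sets\<close>

lemma set_nn_integral_pos_lebesgue: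
  assumes "A \<in> sets pos_lebesgue"
  shows "(\<integral>\<^sup>+t\<in>A. f t \<partial>pos_lebesgue) = (\<integral>\<^sup>+t. f t \<partial>lebesgue_on A)"
proof -
  have A: "A \<subseteq> {0<..}" "A \<in> sets lebesgue" using assms by (auto simp: sets_pos_lebesgue_iff)
  have "(\<integral>\<^sup>+t\<in>A. f t \<partial>pos_lebesgue) = (\<integral>\<^sup>+t. f t * indicator A t * indicator {0<..} t \<partial>lebesgue)"
    by (rule nn_integral_restrict_space) simp
  also have "\<dots> = (\<integral>\<^sup>+t. f t * indicator A t \<partial>lebesgue)"
    by (rule nn_integral_cong) (use A in \<open>auto split: split_indicator\<close>)
  also have "\<dots> = (\<integral>\<^sup>+t. f t \<partial>lebesgue_on A)"
    by (rule nn_integral_restrict_space[symmetric]) (use A in simp)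
  finally show ?thesis .
qed

text \<open>The layer-cake formula on \<open>(a, b]\<close>, a space of finite measure. It shows
  that rearranging preserves the integral.\<close>

lemma nn_integral_Ioc_cong_level_sets:
  assumes "f \<in> M_plus" "g \<in> M_plus" "0 \<le> a"
    and eq: "\<And>s. 0 \<le> s \<Longrightarrow> emeasure lebesgue ({t \<in> {0<..}. ennreal s < f t} \<inter> {a<..b}) =
      emeasure lebesgue ({t \<in> {0<..}. ennreal s < g t} \<inter> {a<..b})"
  shows "(\<integral>\<^sup>+t\<in>{a<..b}. f t \<partial>pos_lebesgue) = (\<integral>\<^sup>+t\<in>{a<..b}. g t \<partial>pos_lebesgue)"
proof -
  have J: "{a<..b} \<in> sets pos_lebesgue" "{a<..b} \<subseteq> {0<..}" using assms by auto
  have fin: "finite_measure (lebesgue_on {a<..b})"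
    by (rule finite_measureI, cases "a \<le> b") (simp_all add: emeasure_restrict_space)
  have sf: "sigma_finite_measure (lebesgue_on {a<..b})"
    using fin by (rule finite_measure.axioms(1))
  have meas: "h \<in> borel_measurable (lebesgue_on {a<..b})" if "h \<in> M_plus" for h
    by (rule measurable_restrict_mono[OF _ J(2)]) (use that in \<open>simp add: M_plus_def\<close>)
  have "{x \<in> {a<..b}. ennreal s < h x} = {t \<in> {0<..}. ennreal s < h t} \<inter> {a<..b}" for h s
    using J(2) by auto
  then have "(\<integral>\<^sup>+t. f t \<partial>lebesgue_on {a<..b}) = (\<integral>\<^sup>+t. g t \<partial>lebesgue_on {a<..b})"
    using eq
    by (auto simp: nn_integral_layer_cake[OF sf meas[OF assms(1)]] nn_integral_layer_cake[OF sf meas[OF assms(2)]]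
        emeasure_restrict_space intro!: nn_integral_cong split: split_indicator)
  then show ?thesis by (simp add: set_nn_integral_pos_lebesgue[OF J(1)])
qed

section \<open>Averaging over an interval\<close>

text \<open>Let \<open>g\<close> be \<open>f\<close> rearranged on \<open>(a, b]\<close>, which
  leaves norm and integral unchanged. Below \<open>g\<close> lies the step function of its
  right-endpoint values on \<open>Suc i\<close> cells; rotating its cells bounds the norm after
  averaging it. Its averages dominate numbers \<open>d i\<close> that increase to \<open>c\<close>,
  and the Fatou property gives the limit.\<close>

lemma norm_interval_average_le:
  assumes N: "rearrangement_invariant_norm N" and f: "f \<in> M_plus" "0 \<le> a" "a < b"
    and c: "(\<integral>\<^sup>+t\<in>{a<..b}. f t \<partial>pos_lebesgue) = c * ennreal (b - a)"
  shows "N (\<lambda>t. if a < t \<and> t \<le> b then c else f t) \<le> N f"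
proof -
  define L where "L = b - a"
  then have L: "0 < L" "b = a + L" using f by auto
  define g where "g = rearrange_on f a b"
  have g: "g \<in> M_plus" unfolding g_def by (rule M_plus_rearrange_on[OF f(1)])
  have int_g: "(\<integral>\<^sup>+t\<in>{a<..b}. g t \<partial>pos_lebesgue) = c * ennreal L"
    unfolding L_def c[symmetric] g_def
    by (rule nn_integral_Ioc_cong_level_sets[OF M_plus_rearrange_on f(1,2)])
      (use f emeasure_rearrange_on_level_set[OF f] in auto)
  \<comment> \<open>The first of the \<open>Suc i\<close> cells is left out because \<open>g\<close>
    has no left-endpoint bound there and may be unbounded near \<open>a\<close>.\<close>
  define d where "d i = ennreal (1 / L) * (\<integral>\<^sup>+t\<in>{a + L / real (Suc i)<..b}. g t \<partial>pos_lebesgue)" for i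
  have d_le: "d i \<le> ennreal (1 / real (Suc i)) *
      (\<Sum>p<Suc i. interval_rearrangement f a b ((real p + 1) * (L / real (Suc i))))"
    (is "_ \<le> _ * (\<Sum>p<Suc i. ?v p)") for i
  proof -
    define \<eta> where "\<eta> = L / real (Suc i)"
    have \<eta>: "0 < \<eta>" "b = a + real (Suc i) * \<eta>" using L by (auto simp: \<eta>_def)
    have "(\<integral>\<^sup>+t\<in>{a + real 1 * \<eta><..a + real (Suc i) * \<eta>}. g t \<partial>pos_lebesgue) =
      (\<Sum>p=1..<Suc i. \<integral>\<^sup>+t\<in>{a + real p * \<eta><..a + (real p + 1) * \<eta>}. g t \<partial>pos_lebesgue)"
      by (rule nn_integral_cells) (use g f \<eta> in auto)
    \<comment> \<open>On cell \<open>p\<close> the function \<open>g\<close> is at most its value at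
      the left end, which is the right-endpoint value of cell \<open>p - 1\<close>.\<close>
    also have "\<dots> \<le> (\<Sum>p=1..<Suc i. ?v (p - 1) * ennreal \<eta>)"
    proof (rule sum_mono)
      fix p assume p: "p \<in> {1..<Suc i}"
      have le_b: "a + (real p + 1) * \<eta> \<le> b"
        unfolding \<eta>(2) using p \<eta>(1) by (auto intro!: mult_right_mono)
      have "(\<integral>\<^sup>+t\<in>{a + real p * \<eta><..a + (real p + 1) * \<eta>}. g t \<partial>pos_lebesgue) \<le>
        (\<integral>\<^sup>+t. ?v (p - 1) * indicator {a + real p * \<eta><..a + (real p + 1) * \<eta>} t \<partial>pos_lebesgue)"
      proof (rule nn_integral_mono)
        fix t
        show "g t * indicator {a + real p * \<eta><..a + (real p + 1) * \<eta>} t \<le>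
          ?v (p - 1) * indicator {a + real p * \<eta><..a + (real p + 1) * \<eta>} t"
        proof (cases "t \<in> {a + real p * \<eta><..a + (real p + 1) * \<eta>}")
          case True
          moreover have "0 \<le> real p * \<eta>" using \<eta> by simp
          ultimately have t: "a < t" "t \<le> b" "real p * \<eta> \<le> t - a" using le_b by auto
          have "real (p - 1) + 1 = real p" using p by (simp add: of_nat_diff)
          with t show ?thesis
            unfolding \<eta>_def[symmetric]
            by (auto simp: g_def rearrange_on_def intro!: mult_right_mono interval_rearrangement_antimono)
        qed simp
      qed
      also have "\<dots> = ?v (p - 1) * ennreal \<eta>"
        by (subst nn_integral_cmult_indicator) (use f \<eta> in \<open>auto simp: algebra_simps\<close>)
      finally show "(\<integral>\<^sup>+t\<in>{a + real p * \<eta><..a + (real p + 1) * \<eta>}. g t \<partial>pos_lebesgue) \<le>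
        ?v (p - 1) * ennreal \<eta>" .
    qed
    also have "\<dots> = (\<Sum>p<i. ?v p * ennreal \<eta>)"
      by (rule sum.reindex_bij_witness[of _ Suc "\<lambda>p. p - 1"]) auto
    also have "\<dots> \<le> (\<Sum>p<Suc i. ?v p * ennreal \<eta>)" by (rule sum_mono2) auto
    finally have "d i \<le> ennreal (1 / L) * (\<Sum>p<Suc i. ?v p * ennreal \<eta>)"
      unfolding d_def \<eta>(2)[symmetric] \<eta>_def[symmetric] by (intro mult_left_mono) simp_all
    also have "\<dots> = (ennreal (1 / L) * ennreal \<eta>) * (\<Sum>p<Suc i. ?v p)"
      by (simp only: sum_distrib_left mult_ac)
    also have "ennreal (1 / L) * ennreal \<eta> = ennreal (1 / real (Suc i))"
      using L by (subst ennreal_mult[symmetric]) (auto simp: \<eta>_def)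
    finally show ?thesis .
  qed
  define F where "F i t = (if a < t \<and> t \<le> b then d i else f t)" for i t
  have F: "F i \<in> M_plus" for i
    unfolding F_def[abs_def] by (rule M_plus_interval_if[OF M_plus_const f(1)])
  have NF: "N (F i) \<le> N f" for i
  proof -
    define \<eta> where "\<eta> = L / real (Suc i)"
    have \<eta>: "0 < \<eta>" "b = a + real (Suc i) * \<eta>" using L by (auto simp: \<eta>_def)
    let ?v = "\<lambda>p. interval_rearrangement f a b ((real p + 1) * \<eta>)"
    have "N (F i) \<le> N (replace_cells f a \<eta> (Suc i) (\<lambda>_. ennreal (1 / real (Suc i)) * (\<Sum>p<Suc i. ?v p)))"
    proof (rule norm_mono[OF N F M_plus_replace_cells[OF f(1,2) \<eta>(1)]])
      fix t :: real
      show "F i t \<le> replace_cells f a \<eta> (Suc i) (\<lambda>_. ennreal (1 / real (Suc i)) * (\<Sum>p<Suc i. ?v p)) t"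
        unfolding F_def replace_cells_def \<eta>(2)[symmetric]
        using d_le[of i, folded \<eta>_def] by simp
    qed
    also have "\<dots> \<le> N (replace_cells f a \<eta> (Suc i) ?v)"
      by (rule norm_replace_cells_average_le[OF N f(1,2) \<eta>(1)]) simp
    \<comment> \<open>A right-endpoint value of a non-increasing function is at most its values on
      the cell.\<close>
    also have "\<dots> \<le> N g"
    proof (rule norm_mono[OF N M_plus_replace_cells[OF f(1,2) \<eta>(1)] g])
      fix t :: real
      show "replace_cells f a \<eta> (Suc i) ?v t \<le> g t"
        unfolding replace_cells_def g_def rearrange_on_def \<eta>(2)[symmetric]
        using cell_bounds(2)[OF \<eta>(1), of "t - a"] by (auto intro!: interval_rearrangement_antimono)
    qed
    also have "\<dots> = N f" unfolding g_def by (rule norm_rearrange_on[OF N f])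
    finally show ?thesis .
  qed
  define A where "A i = {a + L / real (Suc i)<..b}" for i
  have A0: "0 \<le> a + L / real (Suc i)" for i using f L by (simp add: add_nonneg_nonneg)
  have mono_A: "A i \<subseteq> A j" if "i \<le> j" for i j
  proof -
    have "L / real (Suc j) \<le> L / real (Suc i)" using that L by (intro divide_left_mono) auto
    then show ?thesis by (auto simp: A_def)
  qed
  have inc_ind: "indicator (A i) t \<le> (indicator (A j) t :: ennreal)" if "i \<le> j" for i j t
    using mono_A[OF that] by (auto split: split_indicator)
  have inc_d: "incseq d"
    unfolding d_def A_def[symmetric]
    by (intro monoI mult_left_mono nn_integral_mono inc_ind) auto
  have lim_d: "d \<longlonglongrightarrow> c"
  proof -
    have "(\<lambda>i. \<integral>\<^sup>+t\<in>A i. g t \<partial>pos_lebesgue) \<longlonglongrightarrow> (\<integral>\<^sup>+t\<in>{a<..b}. g t \<partial>pos_lebesgue)"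
    proof (rule nn_integral_LIMSEQ)
      show "incseq (\<lambda>i t. g t * indicator (A i) t)"
        by (auto intro!: monoI le_funI mult_left_mono inc_ind)
      show "(\<lambda>t. g t * indicator (A i) t) \<in> borel_measurable pos_lebesgue" for i
        unfolding A_def by (rule measurable_times_indicator_Ioc[OF g A0])
      fix t
      show "(\<lambda>i. g t * indicator (A i) t) \<longlonglongrightarrow> g t * indicator {a<..b} t"
      proof (cases "t \<in> {a<..b}")
        case True
        then have "0 < (t - a) / L" using L by simp
        then obtain m where m: "inverse (real (Suc m)) < (t - a) / L" using reals_Archimedean by blast
        then have "L / real (Suc m) < t - a" using L by (simp add: field_simps)
        with True have "t \<in> A m" by (auto simp: A_def)
        then have "\<forall>\<^sub>F i in sequentially. g t * indicator (A i) t = g t * indicator {a<..b} t"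
          using mono_A True by (auto simp: eventually_sequentially intro!: exI[of _ m] split: split_indicator)
        then show ?thesis by (rule tendsto_eventually)
      next
        case False
        have "0 < L / real (Suc i)" for i using L by simp
        with False have "t \<notin> A i" for i using less_trans[of a "a + L / real (Suc i)" t] by (auto simp: A_def)
        with False show ?thesis by simp
      qed
    qed
    then have "(\<lambda>i. ennreal (1 / L) * (\<integral>\<^sup>+t\<in>A i. g t \<partial>pos_lebesgue)) \<longlonglongrightarrow> ennreal (1 / L) * (c * ennreal L)"
      unfolding int_g by (intro ennreal_tendsto_cmult) auto
    moreover have "ennreal (1 / L) * (c * ennreal L) = c * (ennreal (1 / L) * ennreal L)"
      by (simp only: mult.left_commute)
    moreover have "ennreal (1 / L) * ennreal L = 1"
      using L by (subst ennreal_mult[symmetric]) auto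
    ultimately show ?thesis unfolding d_def[abs_def] A_def by simp
  qed
  have "(\<lambda>i. N (F i)) \<longlonglongrightarrow> N (\<lambda>t. if a < t \<and> t \<le> b then c else f t)"
  proof (rule norm_tendsto[OF N F M_plus_interval_if[OF M_plus_const f(1)]])
    fix t
    show "incseq (\<lambda>i. F i t)" using inc_d by (auto simp: F_def mono_def)
    show "(\<lambda>i. F i t) \<longlonglongrightarrow> (if a < t \<and> t \<le> b then c else f t)"
      using lim_d by (auto simp: F_def)
  qed
  then show ?thesis by (rule LIMSEQ_le_const2) (use NF in auto)
qed

section \<open>Dilations\<close>

text \<open>\<open>h\<close> transported along \<open>x \<mapsto> m * x + c\<close>: superlevel sets
  become their affine images. \<open>m = 2\<close> dilates, \<open>m = 1\<close> translates, and
  \<open>c\<close> also accommodates the shift by \<open>2 * \<delta>\<close> from the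
  discretization.\<close>

definition affine_pullback :: "real \<Rightarrow> real \<Rightarrow> (real \<Rightarrow> ennreal) \<Rightarrow> real \<Rightarrow> ennreal" where
  "affine_pullback m c h t = (if c < t then h ((t - c) / m) else 0)"

lemma affine_pullback_level_set:
  assumes "0 < m" "0 \<le> c"
  shows "{t \<in> {0<..}. y < affine_pullback m c h t} = (\<lambda>x. m * x + c) ` {t \<in> {0<..}. y < h t}"
proof (intro equalityI subsetI)
  fix t assume "t \<in> {t \<in> {0<..}. y < affine_pullback m c h t}"
  then have "c < t" "y < h ((t - c) / m)"
    unfolding affine_pullback_def by (auto split: if_splits)
  with assms show "t \<in> (\<lambda>x. m * x + c) ` {t \<in> {0<..}. y < h t}"
    by (intro image_eqI[of _ _ "(t - c) / m"]) auto
next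
  fix t assume "t \<in> (\<lambda>x. m * x + c) ` {t \<in> {0<..}. y < h t}"
  then obtain x where "t = m * x + c" "0 < x" "y < h x" by auto
  moreover from this assms have "c < m * x + c" "0 < m * x + c" by (auto intro!: add_pos_nonneg)
  ultimately show "t \<in> {t \<in> {0<..}. y < affine_pullback m c h t}"
    using assms by (auto simp: affine_pullback_def)
qed

text \<open>The image is the preimage under the inverse affine map, which is Lebesgue
  measurable.\<close>

lemma sets_lebesgue_affine_image:
  fixes S :: "real set"
  assumes "S \<in> sets lebesgue" "0 < m"
  shows "(\<lambda>x. m * x + c) ` S \<in> sets lebesgue"
proof -
  have "(\<lambda>x. - c / m + 1 / m * x) \<in> lebesgue \<rightarrow>\<^sub>M lebesgue"
    using lebesgue_affine_measurable[of "\<lambda>_::real. 1 / m" "- c / m"] assms(2) by simp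
  from measurable_sets[OF this assms(1)]
  have "(\<lambda>x. - c / m + 1 / m * x) -` S \<in> sets lebesgue" by simp
  also have "(\<lambda>x. - c / m + 1 / m * x) -` S = (\<lambda>x. m * x + c) ` S"
  proof (intro equalityI subsetI)
    fix t assume "t \<in> (\<lambda>x. - c / m + 1 / m * x) -` S"
    then show "t \<in> (\<lambda>x. m * x + c) ` S"
      using assms(2) by (intro image_eqI[of _ _ "- c / m + 1 / m * t"]) (auto simp: field_simps)
  next
    fix t assume "t \<in> (\<lambda>x. m * x + c) ` S"
    then obtain x where "t = m * x + c" "x \<in> S" by auto
    moreover from this have "- c / m + 1 / m * t = x" using assms(2) by (simp add: field_simps)
    ultimately show "t \<in> (\<lambda>x. - c / m + 1 / m * x) -` S" by simp
  qed
  finally show ?thesis .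
qed

lemma M_plus_affine_pullback:
  assumes "h \<in> M_plus" "0 < m" "0 \<le> c"
  shows "affine_pullback m c h \<in> M_plus"
  by (rule M_plusI)
    (use sets_lebesgue_affine_image[OF M_plusD[OF assms(1)] assms(2)]
     in \<open>simp only: affine_pullback_level_set[OF assms(2,3)]\<close>)

lemma emeasure_affine_pullback:
  assumes "0 < m" "0 \<le> c"
  shows "emeasure lebesgue {t \<in> {0<..}. y < affine_pullback m c h t} =
    ennreal m * emeasure lebesgue {t \<in> {0<..}. y < h t}"
  unfolding affine_pullback_level_set[OF assms]
  using emeasure_lebesgue_affine[of m c "{t \<in> {0<..}. y < h t}"] assms by simp

text \<open>
  The dilate of \<open>h\<close> by the factor 2 is equimeasurable with the sum of \<open>h\<close> and a translate of \<open>h\<close>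
  beyond its support.
\<close>

lemma norm_dilation_le:
  assumes N: "rearrangement_invariant_norm N" and h: "h \<in> M_plus" and "0 \<le> c" "0 \<le> B"
    and supp: "\<And>t. B < t \<Longrightarrow> h t = 0"
  shows "N (affine_pullback 2 c h) \<le> 2 * N h"
proof -
  let ?k = "affine_pullback 1 B h"
  have k: "?k \<in> M_plus" by (rule M_plus_affine_pullback) (use h assms in auto)
  have Nk: "N ?k = N h"
    by (rule norm_equimeasurable[OF N k h]) (use assms in \<open>simp add: emeasure_affine_pullback del: greaterThan_iff\<close>)
  have "N (affine_pullback 2 c h) = N (\<lambda>t. h t + ?k t)"
  proof (rule norm_equimeasurable[OF N M_plus_affine_pullback[OF h] M_plus_add[OF h k]])
    fix s :: real assume "0 \<le> s"
    let ?A = "\<lambda>f. {t \<in> {0<..}. ennreal s < f t}"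
    have "?A (\<lambda>t. h t + ?k t) = ?A h \<union> ?A ?k"
      using supp by (force simp: affine_pullback_def)
    also have "emeasure lebesgue \<dots> = emeasure lebesgue (?A h) + emeasure lebesgue (?A ?k)"
    proof (rule plus_emeasure[symmetric])
      show "?A h \<inter> ?A ?k = {}" using supp by (auto simp: affine_pullback_def)
    qed (rule M_plusD[OF h], rule M_plusD[OF k])
    also have "emeasure lebesgue (?A ?k) = emeasure lebesgue (?A h)"
      using assms by (simp add: emeasure_affine_pullback del: greaterThan_iff)
    also have "emeasure lebesgue (?A h) + emeasure lebesgue (?A h) =
        emeasure lebesgue (?A (affine_pullback 2 c h))"
      using assms by (simp add: emeasure_affine_pullback mult_2 del: greaterThan_iff)
    finally show "emeasure lebesgue (?A (affine_pullback 2 c h)) =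
        emeasure lebesgue (?A (\<lambda>t. h t + ?k t))" by simp
  qed (use assms in auto)
  also have "\<dots> \<le> N h + N ?k" by (rule norm_add_le[OF N h k])
  also have "\<dots> = 2 * N h" by (simp add: Nk mult_2)
  finally show ?thesis .
qed

section \<open>Step functions\<close>

lemma nn_integral_Ioc_ge:
  assumes "0 \<le> u" "u \<le> v" "\<And>s. u < s \<Longrightarrow> s \<le> v \<Longrightarrow> c \<le> g s"
  shows "c * ennreal (v - u) \<le> (\<integral>\<^sup>+s\<in>{u<..v}. g s \<partial>pos_lebesgue)"
proof -
  have "c * ennreal (v - u) = (\<integral>\<^sup>+s. c * indicator {u<..v} s \<partial>pos_lebesgue)"
    using assms by (subst nn_integral_cmult_indicator) auto
  also have "\<dots> \<le> (\<integral>\<^sup>+s\<in>{u<..v}. g s \<partial>pos_lebesgue)"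
    by (rule nn_integral_mono) (use assms in \<open>auto split: split_indicator\<close>)
  finally show ?thesis .
qed

text \<open>The coefficients are real because level sequences involve subtraction.
  \<open>ennreal\<close> sends negative ones to 0, so non-negativity is carried along
  separately.\<close>

definition step :: "real \<Rightarrow> nat \<Rightarrow> (nat \<Rightarrow> real) \<Rightarrow> real \<Rightarrow> ennreal" where
  "step \<delta> n c = replace_cells (\<lambda>_. 0) 0 \<delta> n (\<lambda>j. ennreal (c j))"

lemma step_eq: "step \<delta> n c t = (if 0 < t \<and> t \<le> real n * \<delta> then ennreal (c (cell \<delta> t)) else 0)"
  by (simp add: step_def replace_cells_def)

lemma M_plus_step: "0 < \<delta> \<Longrightarrow> step \<delta> n c \<in> M_plus"
  unfolding step_def by (rule M_plus_replace_cells) auto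

lemma step_on_cell:
  assumes "0 < \<delta>" "p < n" "real p * \<delta> < t" "t \<le> (real p + 1) * \<delta>"
  shows "step \<delta> n c t = ennreal (c p)"
proof -
  have "0 \<le> real p * \<delta>" using assms by simp
  with assms have t: "0 < t" by linarith
  then have "cell \<delta> t = p" using cell_eq_iff[OF assms(1) t] assms by blast
  moreover from this have "t \<le> real n * \<delta>" using cell_less_iff[OF assms(1) t] assms by blast
  ultimately show ?thesis using t by (simp add: step_eq)
qed

lemma nn_integral_step_cell:
  assumes "0 < \<delta>" "p < n"
  shows "(\<integral>\<^sup>+t\<in>{0 + real p * \<delta><..0 + (real p + 1) * \<delta>}. step \<delta> n c t \<partial>pos_lebesgue) = ennreal (c p) * ennreal \<delta>"
proof -
  have "(\<integral>\<^sup>+t\<in>{0 + real p * \<delta><..0 + (real p + 1) * \<delta>}. step \<delta> n c t \<partial>pos_lebesgue) =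
    (\<integral>\<^sup>+t. ennreal (c p) * indicator {real p * \<delta><..(real p + 1) * \<delta>} t \<partial>pos_lebesgue)"
    by (rule nn_integral_cong) (use step_on_cell[OF assms] in \<open>auto split: split_indicator\<close>)
  also have "\<dots> = ennreal (c p) * ennreal ((real p + 1) * \<delta> - real p * \<delta>)"
    using assms by (subst nn_integral_cmult_indicator) (auto simp: mult_right_mono)
  also have "(real p + 1) * \<delta> - real p * \<delta> = \<delta>" by (simp add: algebra_simps)
  finally show ?thesis .
qed

text \<open>The cells are averaged one after the other: after \<open>k\<close> rounds the function
  is still \<open>f\<close> to the right of \<open>k * \<delta>\<close>, so the next interval
  average has the expected value.\<close>

lemma norm_step_averages_le:
  assumes N: "rearrangement_invariant_norm N" and f: "f \<in> M_plus" and \<delta>: "0 < \<delta>"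
    and avg: "\<And>p. p < n \<Longrightarrow>
      (\<integral>\<^sup>+t\<in>{real p * \<delta><..(real p + 1) * \<delta>}. f t \<partial>pos_lebesgue) = ennreal (a p) * ennreal \<delta>"
  shows "N (step \<delta> n a) \<le> N f"
proof -
  let ?R = "\<lambda>k. replace_cells f 0 \<delta> k (\<lambda>j. ennreal (a j))"
  have R: "?R k \<in> M_plus" for k by (rule M_plus_replace_cells) (use f \<delta> in auto)
  have "N (?R k) \<le> N f" if "k \<le> n" for k
    using that
  proof (induction k)
    case 0
    show ?case by (rule norm_mono[OF N R f]) (auto simp: replace_cells_def)
  next
    case (Suc k)
    let ?a = "real k * \<delta>" and ?b = "(real k + 1) * \<delta>"
    have ab: "0 \<le> ?a" "?a < ?b" using \<delta> by (auto intro!: mult_strict_right_mono)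
    have "?R (Suc k) t = (if ?a < t \<and> t \<le> ?b then ennreal (a k) else ?R k t)" for t
    proof (cases "?a < t \<and> t \<le> ?b")
      case True
      with ab have t: "0 < t" by linarith
      from True have "cell \<delta> t = k" using cell_eq_iff[OF \<delta> t] by blast
      with True t show ?thesis by (simp add: replace_cells_def add.commute)
    next
      case False
      with ab show ?thesis by (auto simp: replace_cells_def add.commute)
    qed
    then have "N (?R (Suc k)) = N (\<lambda>t. if ?a < t \<and> t \<le> ?b then ennreal (a k) else ?R k t)"
      by presburger
    also have "\<dots> \<le> N (?R k)"
    proof (rule norm_interval_average_le[OF N R ab])
      have "(\<integral>\<^sup>+t\<in>{?a<..?b}. ?R k t \<partial>pos_lebesgue) = (\<integral>\<^sup>+t\<in>{?a<..?b}. f t \<partial>pos_lebesgue)"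
        by (rule nn_integral_cong) (auto simp: replace_cells_def split: split_indicator)
      also have "\<dots> = ennreal (a k) * ennreal (?b - ?a)"
        using avg[of k] Suc.prems by (simp add: algebra_simps)
      finally show "(\<integral>\<^sup>+t\<in>{?a<..?b}. ?R k t \<partial>pos_lebesgue) = ennreal (a k) * ennreal (?b - ?a)" .
    qed
    also have "\<dots> \<le> N f" using Suc by simp
    finally show ?case .
  qed
  \<comment> \<open>\<open>step\<close> vanishes beyond the last cell, where \<open>?R n\<close>
    still equals \<open>f\<close>.\<close>
  moreover have "N (step \<delta> n a) \<le> N (?R n)"
    by (rule norm_mono[OF N M_plus_step[OF \<delta>] R]) (auto simp: step_eq replace_cells_def)
  ultimately show ?thesis by (blast intro: order_trans)
qed

text \<open>Averaging coefficients \<open>k\<close> to \<open>l - 1\<close> is averaging the step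
  function over the interval \<open>(k * \<delta>, l * \<delta>]\<close>.\<close>

lemma norm_step_block_average_le:
  assumes N: "rearrangement_invariant_norm N" and \<delta>: "0 < \<delta>" and kl: "k < l" "l \<le> n"
    and c: "\<And>j. 0 \<le> c j"
  shows "N (step \<delta> n (block_average k l c)) \<le> N (step \<delta> n c)"
proof -
  define m where "m = (\<Sum>i=k..<l. c i) / real (l - k)"
  have m: "0 \<le> m" unfolding m_def by (intro divide_nonneg_nonneg sum_nonneg c) simp
  let ?a = "real k * \<delta>" and ?b = "real l * \<delta>"
  have ab: "0 \<le> ?a" "?a < ?b" using \<delta> kl by (auto intro!: mult_strict_right_mono)
  have bn: "?b \<le> real n * \<delta>" using \<delta> kl by (intro mult_right_mono) auto
  have "step \<delta> n (block_average k l c) t = (if ?a < t \<and> t \<le> ?b then ennreal m else step \<delta> n c t)" for t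
  proof (cases "0 < t")
    case True
    have 1: "cell \<delta> t < l \<longleftrightarrow> t \<le> ?b" by (rule cell_less_iff[OF \<delta> True])
    have 2: "cell \<delta> t < k \<longleftrightarrow> t \<le> ?a" by (rule cell_less_iff[OF \<delta> True])
    show ?thesis
    proof (cases "?a < t \<and> t \<le> ?b")
      case in_ab: True
      then have "k \<le> cell \<delta> t" "cell \<delta> t < l" using 1 2 by linarith+
      with True in_ab bn show ?thesis by (simp add: step_eq block_average_def m_def)
    next
      case False
      then have "\<not> (k \<le> cell \<delta> t \<and> cell \<delta> t < l)" using 1 2 by linarith
      with False show ?thesis by (auto simp: step_eq block_average_def)
    qed
  next
    case False
    with ab show ?thesis by (auto simp: step_eq)
  qed
  then have "N (step \<delta> n (block_average k l c)) = N (\<lambda>t. if ?a < t \<and> t \<le> ?b then ennreal m else step \<delta> n c t)"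
    by presburger
  also have "\<dots> \<le> N (step \<delta> n c)"
  proof (rule norm_interval_average_le[OF N M_plus_step[OF \<delta>] ab])
    have "(\<integral>\<^sup>+t\<in>{0 + ?a<..0 + ?b}. step \<delta> n c t \<partial>pos_lebesgue) =
      (\<Sum>p=k..<l. \<integral>\<^sup>+t\<in>{0 + real p * \<delta><..0 + (real p + 1) * \<delta>}. step \<delta> n c t \<partial>pos_lebesgue)"
      by (rule nn_integral_cells) (use M_plus_step[OF \<delta>] \<delta> kl in auto)
    also have "\<dots> = (\<Sum>p=k..<l. ennreal (c p * \<delta>))"
    proof (rule sum.cong[OF refl])
      fix p assume "p \<in> {k..<l}"
      then have "p < n" using kl by auto
      from nn_integral_step_cell[OF \<delta> this, of c] show
        "(\<integral>\<^sup>+t\<in>{0 + real p * \<delta><..0 + (real p + 1) * \<delta>}. step \<delta> n c t \<partial>pos_lebesgue) = ennreal (c p * \<delta>)"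
        using c \<delta> by (simp add: ennreal_mult)
    qed
    also have "\<dots> = ennreal (\<Sum>p=k..<l. c p * \<delta>)"
      by (rule sum_ennreal) (use c \<delta> in auto)
    also have "(\<Sum>p=k..<l. c p * \<delta>) = m * (?b - ?a)"
      using kl by (simp add: m_def sum_distrib_right[symmetric] of_nat_diff left_diff_distrib[symmetric])
    finally show "(\<integral>\<^sup>+t\<in>{?a<..?b}. step \<delta> n c t \<partial>pos_lebesgue) = ennreal m * ennreal (?b - ?a)"
      using m ab by (simp add: ennreal_mult)
  qed
  finally show ?thesis .
qed

lemma nonincreasing_step:
  assumes "0 < \<delta>" "\<And>i j. i \<le> j \<Longrightarrow> j < n \<Longrightarrow> b j \<le> b i"
  shows "nonincreasing (step \<delta> n b)"
  unfolding nonincreasing_def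
proof (rule monotone_onI)
  fix s t :: real assume st: "s \<in> {0<..}" "t \<in> {0<..}" "s \<le> t"
  show "step \<delta> n b t \<le> step \<delta> n b s"
  proof (cases "t \<le> real n * \<delta>")
    case True
    with st have "cell \<delta> t < n" using cell_less_iff[OF assms(1)] by simp
    moreover have "cell \<delta> s \<le> cell \<delta> t" by (rule cell_mono) (use assms st in auto)
    ultimately show ?thesis using True st assms(2) by (auto simp: step_eq intro!: ennreal_leI)
  qed (simp add: step_eq)
qed

section \<open>Tail integrals\<close>

context
  fixes I :: "real \<Rightarrow> real"
  assumes I_pos: "\<And>t. 0 < t \<Longrightarrow> 0 < I t"
    and I_mono: "mono_on {0<..} I"
begin

section \<open>The weight \<open>1 / I\<close>\<close>

lemma inverse_I_le: "0 < s \<Longrightarrow> s \<le> t \<Longrightarrow> 1 / I t \<le> 1 / I s"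
  using I_pos mono_onD[OF I_mono, of s t] by (intro divide_left_mono) (auto intro!: mult_pos_pos)

lemma inverse_I_nonneg: "0 < s \<Longrightarrow> 0 \<le> 1 / I s"
  using I_pos[of s] by simp

lemma divide_I: "0 < s \<Longrightarrow> x / ennreal (I s) = x * ennreal (1 / I s)"
  using I_pos[of s] by (simp add: divide_ennreal_def inverse_ennreal inverse_eq_divide)

lemma M_plus_divide_I:
  assumes "f \<in> M_plus"
  shows "(\<lambda>s. f s / ennreal (I s)) \<in> M_plus"
proof -
  have "(\<lambda>s. inverse (ennreal (I s))) \<in> M_plus"
  proof (rule M_plus_antimono, rule monotone_onI)
    fix s t :: real assume "s \<in> {0<..}" "t \<in> {0<..}" "s \<le> t"
    then show "inverse (ennreal (I t)) \<le> inverse (ennreal (I s))"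
      using I_pos inverse_I_le[of s t]
      by (simp add: inverse_ennreal inverse_eq_divide ennreal_leI)
  qed
  with assms show ?thesis unfolding divide_ennreal_def M_plus_def by measurable
qed

section \<open>The tail integral as a function of its lower limit\<close>

lemma tail_integral_antimono: "s \<le> t \<Longrightarrow> tail_integral I f t \<le> tail_integral I f s"
  unfolding tail_integral_def by (rule nn_integral_mono) (auto split: split_indicator)

lemma M_plus_tail_integral: "tail_integral I f \<in> M_plus"
  by (rule M_plus_antimono) (auto intro!: monotone_onI tail_integral_antimono)

lemma tail_integral_eq_0:
  assumes "\<And>s. t < s \<Longrightarrow> f s = 0"
  shows "tail_integral I f t = 0"
proof -
  have "tail_integral I f t = (\<integral>\<^sup>+s. 0 \<partial>pos_lebesgue)"
    unfolding tail_integral_def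
    by (rule nn_integral_cong) (use assms in \<open>auto split: split_indicator\<close>)
  then show ?thesis by simp
qed

text \<open>On each cell \<open>1 / I\<close> is at most its value at the left end. In the cell of
  \<open>t\<close> only points beyond \<open>t\<close> count, so \<open>t\<close> replaces the left
  end there; this is the \<open>max\<close>.\<close>

lemma tail_integral_cells_le:
  assumes f: "f \<in> M_plus" and \<delta>: "0 < \<delta>" and t: "0 < t" "cell \<delta> t = k" "k < n"
    and avg: "\<And>p. p < n \<Longrightarrow>
      (\<integral>\<^sup>+t\<in>{real p * \<delta><..(real p + 1) * \<delta>}. f t \<partial>pos_lebesgue) = ennreal (a p) * ennreal \<delta>"
    and a: "\<And>j. 0 \<le> a j"
  shows "tail_integral I (\<lambda>s. f s * indicator {0<..real n * \<delta>} s) t \<le>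
    ennreal (\<delta> * (\<Sum>j=k..<n. 1 / I (max (real j * \<delta>) t) * a j))"
proof -
  \<comment> \<open>Setting the integrand to 0 up to \<open>t\<close> lets the integral start at the
    left end \<open>k * \<delta>\<close> of the cell of \<open>t\<close>.\<close>
  define g where "g s = (if 0 < s \<and> s \<le> t then 0 else f s / ennreal (I s))" for s
  have g: "g \<in> M_plus"
    unfolding g_def[abs_def] by (rule M_plus_interval_if[OF M_plus_const M_plus_divide_I[OF f]])
  have k: "real k * \<delta> < t" "t \<le> (real k + 1) * \<delta>" using cell_eq_iff[OF \<delta> t(1)] t(2) by blast+
  have "tail_integral I (\<lambda>s. f s * indicator {0<..real n * \<delta>} s) t \<le>
    (\<integral>\<^sup>+s\<in>{0 + real k * \<delta><..0 + real n * \<delta>}. g s \<partial>pos_lebesgue)"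
    unfolding tail_integral_def
    by (rule nn_integral_mono) (use t k in \<open>auto simp: g_def split: split_indicator\<close>)
  also have "\<dots> = (\<Sum>p=k..<n. \<integral>\<^sup>+s\<in>{0 + real p * \<delta><..0 + (real p + 1) * \<delta>}. g s \<partial>pos_lebesgue)"
    by (rule nn_integral_cells) (use g \<delta> t in auto)
  also have "\<dots> \<le> (\<Sum>p=k..<n. ennreal (\<delta> * (1 / I (max (real p * \<delta>) t) * a p)))"
  proof (rule sum_mono)
    fix p assume p: "p \<in> {k..<n}"
    let ?w = "1 / I (max (real p * \<delta>) t)"
    have w: "0 \<le> ?w" by (rule inverse_I_nonneg) (use t in auto)
    have "(\<integral>\<^sup>+s\<in>{0 + real p * \<delta><..0 + (real p + 1) * \<delta>}. g s \<partial>pos_lebesgue) \<le>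
      (\<integral>\<^sup>+s. ennreal ?w * (f s * indicator {real p * \<delta><..(real p + 1) * \<delta>} s) \<partial>pos_lebesgue)"
    proof (rule nn_integral_mono)
      fix s assume "s \<in> space pos_lebesgue"
      then have s: "0 < s" by simp
      have "f s / ennreal (I s) \<le> ennreal ?w * f s" if "real p * \<delta> < s" "t < s"
      proof -
        have "1 / I s \<le> ?w" by (rule inverse_I_le) (use that t in auto)
        then have "f s * ennreal (1 / I s) \<le> f s * ennreal ?w" by (intro mult_left_mono ennreal_leI) auto
        then show ?thesis using divide_I[OF s] by (simp add: mult.commute)
      qed
      then show "g s * indicator {0 + real p * \<delta><..0 + (real p + 1) * \<delta>} s \<le>
        ennreal ?w * (f s * indicator {real p * \<delta><..(real p + 1) * \<delta>} s)"
        using s by (auto simp: g_def split: split_indicator)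
    qed
    also have "\<dots> = ennreal ?w * (\<integral>\<^sup>+s\<in>{real p * \<delta><..(real p + 1) * \<delta>}. f s \<partial>pos_lebesgue)"
      by (rule nn_integral_cmult[OF measurable_times_indicator_Ioc[OF f]]) (use \<delta> in simp)
    also have "\<dots> = ennreal (\<delta> * (?w * a p))"
      using p avg[of p] w a[of p] \<delta>
      by (simp add: ennreal_mult[symmetric] mult_ac)
    finally show "(\<integral>\<^sup>+s\<in>{0 + real p * \<delta><..0 + (real p + 1) * \<delta>}. g s \<partial>pos_lebesgue) \<le>
      ennreal (\<delta> * (?w * a p))" .
  qed
  also have "\<dots> = ennreal (\<Sum>p=k..<n. \<delta> * (1 / I (max (real p * \<delta>) t) * a p))"
    by (rule sum_ennreal, intro mult_nonneg_nonneg inverse_I_nonneg) (use a \<delta> t in auto)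
  finally show ?thesis by (simp add: sum_distrib_left)
qed

text \<open>Put \<open>x = (t - 2 * \<delta>) / 2\<close>. The range
  \<open>(x, k * \<delta>]\<close> accounts for the term with \<open>b k\<close> and the range
  \<open>(k * \<delta>, (n - 1) * \<delta>]\<close> for the sum, because the step function and
  \<open>1 / I\<close> are both non-increasing.\<close>

lemma tail_integral_step_ge:
  assumes \<delta>: "0 < \<delta>" and t: "2 * \<delta> < t" "cell \<delta> t = k" "k < n"
    and b: "\<And>j. 0 \<le> b j" and anti: "\<And>i j. i \<le> j \<Longrightarrow> j < n \<Longrightarrow> b j \<le> b i"
  shows "ennreal (\<delta> * ((real k + 1) * b k / I t + (\<Sum>j=Suc k..<n. 1 / I (real j * \<delta>) * b j))) \<le>
    2 * tail_integral I (step \<delta> n b) ((t - 2 * \<delta>) / 2)"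
proof -
  define x where "x = (t - 2 * \<delta>) / 2"
  have "0 < t" using t \<delta> by linarith
  have k: "real k * \<delta> < t" "t \<le> (real k + 1) * \<delta>" using cell_eq_iff[OF \<delta> \<open>0 < t\<close>] t(2) by blast+
  \<comment> \<open>The shift by \<open>2 * \<delta>\<close> turns
    \<open>t \<le> (k + 1) * \<delta>\<close> into \<open>2 * x \<le> (k - 1) * \<delta>\<close>.
    Hence \<open>2 * (k * \<delta> - x) \<ge> (k + 1) * \<delta>\<close>, the source of the factor
    2.\<close>
  have x: "0 < x" "2 * x \<le> (real k - 1) * \<delta>" "x < real k * \<delta>"
  proof -
    show "0 < x" using t by (simp add: x_def)
    have "2 * x = t - 2 * \<delta>" by (simp add: x_def)
    with k show *: "2 * x \<le> (real k - 1) * \<delta>" by (simp add: algebra_simps)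
    show "x < real k * \<delta>" using * \<open>0 < x\<close> \<delta> by (simp add: algebra_simps)
  qed
  let ?g = "\<lambda>s. step \<delta> n b s / ennreal (I s)"
  have g: "?g \<in> M_plus" by (rule M_plus_divide_I[OF M_plus_step[OF \<delta>]])
  have kn: "k \<le> n - 1" "real k * \<delta> \<le> real (n - 1) * \<delta>"
    using t \<delta> by (auto intro!: mult_right_mono)
  have lower: "ennreal (b j * (1 / I r)) \<le> ?g s"
    if "j < n" "0 < s" "s \<le> (real j + 1) * \<delta>" "s \<le> r" for s j r
  proof -
    have "cell \<delta> s < Suc j" by (subst cell_less_iff) (use that \<delta> in \<open>auto simp: add.commute\<close>)
    then have "b j \<le> b (cell \<delta> s)" using anti that by simp
    moreover have "s \<le> real n * \<delta>" using \<open>cell \<delta> s < Suc j\<close> that cell_less_iff[OF \<delta>, of s n] by simp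
    ultimately have "ennreal (b j) \<le> step \<delta> n b s" using that by (simp add: step_eq ennreal_leI)
    moreover have "ennreal (1 / I r) \<le> ennreal (1 / I s)" by (intro ennreal_leI inverse_I_le) (use that in auto)
    ultimately have "ennreal (b j) * ennreal (1 / I r) \<le> step \<delta> n b s * ennreal (1 / I s)"
      by (rule mult_mono) auto
    moreover have "0 \<le> 1 / I r" by (rule inverse_I_nonneg) (use that in auto)
    ultimately show ?thesis unfolding divide_I[OF \<open>0 < s\<close>] ennreal_mult[OF b \<open>0 \<le> 1 / I r\<close>]
      by (simp only:)
  qed
  have first: "ennreal (\<delta> * ((real k + 1) * b k / I t)) \<le> 2 * (\<integral>\<^sup>+s\<in>{x<..real k * \<delta>}. ?g s \<partial>pos_lebesgue)"
  proof -
    have c: "0 \<le> b k * (1 / I t)" using b[of k] I_pos[OF \<open>0 < t\<close>] by simp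
    have "\<delta> * ((real k + 1) * b k / I t) = (b k * (1 / I t)) * ((real k + 1) * \<delta>)" by simp
    also have "\<dots> \<le> (b k * (1 / I t)) * (2 * (real k * \<delta> - x))"
      by (rule mult_left_mono[OF _ c]) (use x in \<open>simp add: algebra_simps\<close>)
    also have "\<dots> = 2 * ((b k * (1 / I t)) * (real k * \<delta> - x))" by (rule mult.left_commute)
    finally have "ennreal (\<delta> * ((real k + 1) * b k / I t)) \<le>
      ennreal (2 * ((b k * (1 / I t)) * (real k * \<delta> - x)))" by (rule ennreal_leI)
    also have "\<dots> = 2 * (ennreal (b k * (1 / I t)) * ennreal (real k * \<delta> - x))"
    proof -
      have "0 \<le> real k * \<delta> - x" using x by simp
      with c show ?thesis by (simp only: ennreal_mult mult_nonneg_nonneg zero_le_numeral ennreal_numeral)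
    qed
    also have "\<dots> \<le> 2 * (\<integral>\<^sup>+s\<in>{x<..real k * \<delta>}. ?g s \<partial>pos_lebesgue)"
      by (intro mult_left_mono nn_integral_Ioc_ge lower)
        (use x t k \<delta> in \<open>auto simp: algebra_simps\<close>)
    finally show ?thesis .
  qed
  \<comment> \<open>Term \<open>j\<close> is charged to cell \<open>j - 1\<close>, which lies to the
    left of \<open>j * \<delta>\<close>. Hence the cells used are \<open>k\<close> to
    \<open>n - 2\<close>.\<close>
  have second: "ennreal (\<delta> * (\<Sum>j=Suc k..<n. 1 / I (real j * \<delta>) * b j)) \<le>
    (\<integral>\<^sup>+s\<in>{real k * \<delta><..real (n - 1) * \<delta>}. ?g s \<partial>pos_lebesgue)"
  proof -
    have nonneg: "0 \<le> \<delta> * (1 / I (real (Suc p) * \<delta>) * b (Suc p))" for p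
      by (intro mult_nonneg_nonneg inverse_I_nonneg b) (use \<delta> in auto)
    have "\<delta> * (\<Sum>j=Suc k..<n. 1 / I (real j * \<delta>) * b j) = (\<Sum>p=k..<n-1. \<delta> * (1 / I (real (Suc p) * \<delta>) * b (Suc p)))"
      unfolding sum_distrib_left
      by (rule sum.reindex_bij_witness[of _ Suc "\<lambda>p. p - 1"])
        (use kn in \<open>auto simp del: of_nat_Suc\<close>)
    also have "ennreal \<dots> = (\<Sum>p=k..<n-1. ennreal (\<delta> * (1 / I (real (Suc p) * \<delta>) * b (Suc p))))"
      by (rule sum_ennreal[symmetric]) (rule nonneg)
    also have "\<dots> \<le> (\<Sum>p=k..<n-1. \<integral>\<^sup>+s\<in>{0 + real p * \<delta><..0 + (real p + 1) * \<delta>}. ?g s \<partial>pos_lebesgue)"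
    proof (rule sum_mono)
      fix p assume p: "p \<in> {k..<n-1}"
      have I: "0 \<le> 1 / I (real (Suc p) * \<delta>)" by (rule inverse_I_nonneg) (use \<delta> in auto)
      have "ennreal (\<delta> * (1 / I (real (Suc p) * \<delta>) * b (Suc p))) =
        ennreal (b (Suc p) * (1 / I (real (Suc p) * \<delta>))) * ennreal ((0 + (real p + 1) * \<delta>) - (0 + real p * \<delta>))"
        using \<delta> I b[of "Suc p"] by (subst ennreal_mult[symmetric]) (auto simp: algebra_simps)
      also have "\<dots> \<le> (\<integral>\<^sup>+s\<in>{0 + real p * \<delta><..0 + (real p + 1) * \<delta>}. ?g s \<partial>pos_lebesgue)"
      proof (rule nn_integral_Ioc_ge)
        fix s assume s: "0 + real p * \<delta> < s" "s \<le> 0 + (real p + 1) * \<delta>"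
        have "0 \<le> real p * \<delta>" using \<delta> by simp
        with s have "0 < s" by linarith
        with s p \<delta> show "ennreal (b (Suc p) * (1 / I (real (Suc p) * \<delta>))) \<le> ?g s"
          by (intro lower) (auto simp: algebra_simps)
      qed (use \<delta> in \<open>auto intro!: mult_right_mono\<close>)
      finally show "ennreal (\<delta> * (1 / I (real (Suc p) * \<delta>) * b (Suc p))) \<le>
        (\<integral>\<^sup>+s\<in>{0 + real p * \<delta><..0 + (real p + 1) * \<delta>}. ?g s \<partial>pos_lebesgue)" .
    qed
    also have "\<dots> = (\<integral>\<^sup>+s\<in>{0 + real k * \<delta><..0 + real (n - 1) * \<delta>}. ?g s \<partial>pos_lebesgue)"
      by (rule nn_integral_cells[symmetric]) (use g \<delta> kn in auto)
    finally show ?thesis by simp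
  qed
  have "(\<integral>\<^sup>+s\<in>{x<..real k * \<delta>}. ?g s \<partial>pos_lebesgue) + (\<integral>\<^sup>+s\<in>{real k * \<delta><..real (n - 1) * \<delta>}. ?g s \<partial>pos_lebesgue) =
    (\<integral>\<^sup>+s. ?g s * indicator {x<..real k * \<delta>} s + ?g s * indicator {real k * \<delta><..real (n - 1) * \<delta>} s \<partial>pos_lebesgue)"
    by (rule nn_integral_add[symmetric]; rule measurable_times_indicator_Ioc[OF g]) (use x \<delta> in auto)
  also have "\<dots> \<le> tail_integral I (step \<delta> n b) x"
    unfolding tail_integral_def by (rule nn_integral_mono) (use x in \<open>auto split: split_indicator\<close>)
  finally have sum_le: "(\<integral>\<^sup>+s\<in>{x<..real k * \<delta>}. ?g s \<partial>pos_lebesgue) +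
    (\<integral>\<^sup>+s\<in>{real k * \<delta><..real (n - 1) * \<delta>}. ?g s \<partial>pos_lebesgue) \<le> tail_integral I (step \<delta> n b) x" .
  have nonneg: "0 \<le> \<delta> * ((real k + 1) * b k / I t)" "0 \<le> \<delta> * (\<Sum>j=Suc k..<n. 1 / I (real j * \<delta>) * b j)"
  proof -
    show "0 \<le> \<delta> * ((real k + 1) * b k / I t)" using \<delta> b[of k] I_pos[OF \<open>0 < t\<close>] by simp
    have w: "0 \<le> 1 / I (real j * \<delta>) * b j" if "j \<in> {Suc k..<n}" for j
      by (intro mult_nonneg_nonneg inverse_I_nonneg b) (use \<delta> that in auto)
    show "0 \<le> \<delta> * (\<Sum>j=Suc k..<n. 1 / I (real j * \<delta>) * b j)"
      by (rule mult_nonneg_nonneg[OF less_imp_le[OF \<delta>] sum_nonneg]) (rule w)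
  qed
  have "ennreal (\<delta> * ((real k + 1) * b k / I t + (\<Sum>j=Suc k..<n. 1 / I (real j * \<delta>) * b j))) =
    ennreal (\<delta> * ((real k + 1) * b k / I t)) + ennreal (\<delta> * (\<Sum>j=Suc k..<n. 1 / I (real j * \<delta>) * b j))"
    unfolding distrib_left[of \<delta>] by (rule ennreal_plus) (rule nonneg)+
  \<comment> \<open>The second integral is doubled as well, so that both ranges combine under one
    factor 2.\<close>
  also have "\<dots> \<le> 2 * (\<integral>\<^sup>+s\<in>{x<..real k * \<delta>}. ?g s \<partial>pos_lebesgue) +
    2 * (\<integral>\<^sup>+s\<in>{real k * \<delta><..real (n - 1) * \<delta>}. ?g s \<partial>pos_lebesgue)"
    using second by (intro add_mono first) (auto simp: mult_2 intro: add_increasing)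
  also have "\<dots> \<le> 2 * tail_integral I (step \<delta> n b) x"
    unfolding distrib_left[symmetric] by (intro mult_left_mono sum_le) simp
  finally show ?thesis unfolding x_def .
qed

text \<open>The sum over the cells from that of \<open>t\<close> on is extended down to the start
  \<open>m\<close> of the block of \<open>t\<close>, where \<open>b\<close> majorizes
  \<open>a\<close> against non-increasing weights. The part of the new sum on the block is at most
  \<open>(k + 1) * b k / I t\<close>.\<close>

lemma tail_integral_le_level:
  assumes f: "f \<in> M_plus" and \<delta>: "0 < \<delta>" and t: "2 * \<delta> < t"
    and avg: "\<And>p. p < n \<Longrightarrow>
      (\<integral>\<^sup>+t\<in>{real p * \<delta><..(real p + 1) * \<delta>}. f t \<partial>pos_lebesgue) = ennreal (a p) * ennreal \<delta>"
    and a: "\<And>j. 0 \<le> a j" and b: "\<And>j. 0 \<le> b j" and level: "level_sequence 0 n a b"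
  shows "tail_integral I (\<lambda>s. f s * indicator {0<..real n * \<delta>} s) t \<le>
    2 * tail_integral I (step \<delta> n b) ((t - 2 * \<delta>) / 2)"
proof -
  have "0 < t" using t \<delta> by linarith
  define k where "k = cell \<delta> t"
  have k: "real k * \<delta> < t" "t \<le> (real k + 1) * \<delta>" using cell_bounds[OF \<delta> \<open>0 < t\<close>] by (auto simp: k_def)
  show ?thesis
  proof (cases "k < n")
    case False
    then have "real n * \<delta> < t" using cell_less_iff[OF \<delta> \<open>0 < t\<close>, of n] by (simp add: k_def)
    then have "tail_integral I (\<lambda>s. f s * indicator {0<..real n * \<delta>} s) t = 0"
      by (intro tail_integral_eq_0) auto
    then show ?thesis by simp
  next
    case True
    note ls = level[unfolded level_sequence_def]
    have anti: "b j \<le> b i" if "i \<le> j" "j < n" for i j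
      using ls[THEN conjunct2, THEN conjunct1] that by blast
    \<comment> \<open>The weight is frozen at \<open>1 / I t\<close> up to the cell of
      \<open>t\<close>: it stays non-increasing and is constant from \<open>m\<close> to
      \<open>k\<close>.\<close>
    define w where "w j = 1 / I (max (real j * \<delta>) t)" for j
    have w_pos: "0 \<le> w j" for j unfolding w_def by (rule inverse_I_nonneg) (use \<open>0 < t\<close> in auto)
    have w: "antimono w"
      unfolding w_def
    proof (intro antimonoI inverse_I_le)
      fix i j :: nat assume "i \<le> j"
      then have "real i * \<delta> \<le> real j * \<delta>" using \<delta> by (intro mult_right_mono) auto
      then show "max (real i * \<delta>) t \<le> max (real j * \<delta>) t" by simp
    qed (use \<open>0 < t\<close> in auto)
    obtain m where m: "m \<le> k" "\<And>j. m \<le> j \<Longrightarrow> j \<le> k \<Longrightarrow> b j = b k"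
      and maj: "(\<Sum>j=m..<n. w j * a j) \<le> (\<Sum>j=m..<n. w j * b j)"
      using ls[THEN conjunct2, THEN conjunct2, THEN conjunct2, THEN conjunct1] True w by blast
    \<comment> \<open>The terms added between \<open>m\<close> and \<open>k\<close> are
      non-negative.\<close>
    have "(\<Sum>j=k..<n. w j * a j) \<le> (\<Sum>j=m..<n. w j * a j)"
      by (rule sum_mono2) (use m w_pos a in auto)
    also note maj
    also have "(\<Sum>j=m..<n. w j * b j) = (\<Sum>j=m..<Suc k. w j * b j) + (\<Sum>j=Suc k..<n. w j * b j)"
      using m True by (subst sum.atLeastLessThan_concat) auto
    \<comment> \<open>At most \<open>k + 1\<close> cells contribute, each with the same term
      \<open>b k / I t\<close>.\<close>
    also have "(\<Sum>j=m..<Suc k. w j * b j) \<le> (real k + 1) * b k / I t"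
    proof -
      have "w j * b j = b k / I t" if "j \<in> {m..<Suc k}" for j
      proof -
        have "real j * \<delta> \<le> real k * \<delta>" using that \<delta> by (intro mult_right_mono) auto
        with k have "max (real j * \<delta>) t = t" by simp
        moreover have "b j = b k" by (rule m(2)) (use that in auto)
        ultimately show ?thesis by (simp add: w_def)
      qed
      then have "(\<Sum>j=m..<Suc k. w j * b j) = real (Suc k - m) * (b k / I t)" by simp
      also have "\<dots> \<le> (real k + 1) * (b k / I t)"
        using b[of k] I_pos[OF \<open>0 < t\<close>] by (intro mult_right_mono) auto
      finally show ?thesis by simp
    qed
    also have "(\<Sum>j=Suc k..<n. w j * b j) = (\<Sum>j=Suc k..<n. 1 / I (real j * \<delta>) * b j)"
    proof (rule sum.cong[OF refl])
      fix j assume "j \<in> {Suc k..<n}"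
      then have "(real k + 1) * \<delta> \<le> real j * \<delta>" using \<delta> by (intro mult_right_mono) auto
      with k have "max (real j * \<delta>) t = real j * \<delta>" by simp
      then show "w j * b j = 1 / I (real j * \<delta>) * b j" by (simp add: w_def)
    qed
    finally have le: "(\<Sum>j=k..<n. w j * a j) \<le>
      (real k + 1) * b k / I t + (\<Sum>j=Suc k..<n. 1 / I (real j * \<delta>) * b j)" by simp
    have "tail_integral I (\<lambda>s. f s * indicator {0<..real n * \<delta>} s) t \<le> ennreal (\<delta> * (\<Sum>j=k..<n. w j * a j))"
      unfolding w_def
      by (rule tail_integral_cells_le[OF f \<delta> \<open>0 < t\<close> k_def[symmetric] True avg a])
    also have "\<dots> \<le> ennreal (\<delta> * ((real k + 1) * b k / I t + (\<Sum>j=Suc k..<n. 1 / I (real j * \<delta>) * b j)))"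
      using le \<delta> by (intro ennreal_leI mult_left_mono) auto
    also have "\<dots> \<le> 2 * tail_integral I (step \<delta> n b) ((t - 2 * \<delta>) / 2)"
      by (rule tail_integral_step_ge[OF \<delta> t k_def[symmetric] True b anti])
    finally show ?thesis .
  qed
qed

end

section \<open>Reduction to non-increasing functions\<close>

text \<open>Both the passage to cell averages and every later block average are interval averages,
  so neither increases the norm.\<close>

lemma ex_level_sequence_of_averages:
  assumes X: "rearrangement_invariant_norm X" and f: "f \<in> nonneg_space X" and \<delta>: "0 < \<delta>"
  obtains a b where
    "\<And>p. (\<integral>\<^sup>+t\<in>{real p * \<delta><..(real p + 1) * \<delta>}. f t \<partial>pos_lebesgue) = ennreal (a p) * ennreal \<delta>"
    "\<And>j. 0 \<le> a j" "\<And>j. 0 \<le> b j" "level_sequence 0 n a b" "X (step \<delta> n b) \<le> X f"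
proof -
  have fM: "f \<in> M_plus" and fin: "X f < \<infinity>" using f by (auto simp: nonneg_space_def)
  \<comment> \<open>\<open>enn2real\<close> would send an infinite integral to 0; the local
    integrability axiom and \<open>X f < \<infinity>\<close> exclude this case.\<close>
  define a where "a p = enn2real (\<integral>\<^sup>+t\<in>{real p * \<delta><..(real p + 1) * \<delta>}. f t \<partial>pos_lebesgue) / \<delta>" for p
  have a: "0 \<le> a p" for p using \<delta> by (simp add: a_def)
  have avg: "(\<integral>\<^sup>+t\<in>{real p * \<delta><..(real p + 1) * \<delta>}. f t \<partial>pos_lebesgue) = ennreal (a p) * ennreal \<delta>" for p
  proof -
    have "{real p * \<delta><..(real p + 1) * \<delta>} \<in> sets pos_lebesgue"
      "emeasure pos_lebesgue {real p * \<delta><..(real p + 1) * \<delta>} < \<infinity>"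
      using \<delta> by (auto simp: mult_right_mono)
    then obtain C where "(\<integral>\<^sup>+t\<in>{real p * \<delta><..(real p + 1) * \<delta>}. f t \<partial>pos_lebesgue) \<le> ennreal C * X f"
      using norm_integral_bound[OF X] fM by metis
    also have "\<dots> < \<infinity>" using fin by (simp add: ennreal_mult_less_top)
    finally have "(\<integral>\<^sup>+t\<in>{real p * \<delta><..(real p + 1) * \<delta>}. f t \<partial>pos_lebesgue) =
      ennreal (a p * \<delta>)"
      using \<delta> by (simp add: a_def)
    then show ?thesis using a \<delta> by (simp add: ennreal_mult)
  qed
  obtain b where level: "level_sequence 0 n a b" using level_sequence_exists[of 0 n a] by auto
  \<comment> \<open>The family to which the closedness of level sequences is applied; it transfers
    non-negativity and the norm bound from \<open>a\<close> to \<open>b\<close>.\<close>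
  define S where "S = {c. (\<forall>j. 0 \<le> c j) \<and> X (step \<delta> n c) \<le> X f}"
  have "a \<in> S"
    using a norm_step_averages_le[OF X fM \<delta> avg] by (simp add: S_def)
  moreover have "block_average k l c \<in> S" if c: "c \<in> S" and kl: "k < l" "l \<le> n" for c k l
  proof -
    have c0: "0 \<le> c j" for j using c by (simp add: S_def)
    have "0 \<le> block_average k l c j" for j
      unfolding block_average_def by (auto intro!: divide_nonneg_nonneg sum_nonneg c0)
    moreover have "X (step \<delta> n (block_average k l c)) \<le> X f"
      using norm_step_block_average_le[OF X \<delta> kl, of c, OF c0] c by (auto simp: S_def intro: order_trans)
    ultimately show ?thesis by (simp add: S_def)
  qed
  ultimately have "b \<in> S"
    using level[unfolded level_sequence_def, THEN conjunct2, THEN conjunct2, THEN conjunct2, THEN conjunct2]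
    by blast
  then show thesis using that[OF avg a _ level] by (auto simp: S_def)
qed

text \<open>The indicator of \<open>(0, 1]\<close> has positive finite norm in \<open>X\<close>, so
  a negative constant would force a negative value of \<open>Y\<close>. This justifies moving the
  bound from \<open>ereal\<close> to \<open>ennreal\<close>.\<close>

lemma nonneg_tail_bound_constant:
  assumes X: "rearrangement_invariant_norm X"
    and bound: "\<And>f. f \<in> nonneg_space X \<Longrightarrow> nonincreasing f \<Longrightarrow> tail_bound I X Y C f"
  shows "0 \<le> C"
proof (rule ccontr)
  assume "\<not> 0 \<le> C"
  let ?g = "indicator {0<..1::real} :: real \<Rightarrow> ennreal"
  have mono: "nonincreasing ?g"
    unfolding nonincreasing_def by (rule monotone_onI) (auto split: split_indicator)
  then have g: "?g \<in> M_plus" unfolding nonincreasing_def by (rule M_plus_antimono)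
  have "emeasure pos_lebesgue {0<..1::real} < \<infinity>" by simp
  then have fin: "X ?g < \<infinity>" by (intro norm_indicator_finite[OF X]) auto
  have "X ?g \<noteq> 0"
  proof
    assume "X ?g = 0"
    then have "AE t in pos_lebesgue. ?g t = 0" using norm_eq_0_iff[OF X g] by simp
    then have "(\<integral>\<^sup>+t. ?g t \<partial>pos_lebesgue) = 0"
      using nn_integral_cong_AE[of ?g "\<lambda>_. 0" pos_lebesgue] by simp
    moreover have "(\<integral>\<^sup>+t. ?g t \<partial>pos_lebesgue) = emeasure pos_lebesgue {0<..1::real}"
      by (rule nn_integral_indicator) simp
    ultimately show False by simp
  qed
  with fin obtain r where r: "X ?g = ennreal r" "0 < r"
    by (cases "X ?g") (auto simp: less_le)
  have "enn2ereal (Y (tail_integral I ?g)) \<le> ereal C * enn2ereal (X ?g)"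
    using bound[OF _ mono] g fin by (simp add: nonneg_space_def tail_bound_def)
  also have "\<dots> = ereal (C * r)" using r by (simp add: enn2ereal_ennreal)
  also have "\<dots> < 0" using r \<open>\<not> 0 \<le> C\<close> by (simp add: mult_neg_pos)
  finally show False using enn2ereal_nonneg[of "Y (tail_integral I ?g)"] by (meson not_le)
qed

lemma tail_bound_iff:
  assumes "0 \<le> C"
  shows "tail_bound I X Y C f \<longleftrightarrow> Y (tail_integral I f) \<le> ennreal C * X f"
  using assms by (simp add: tail_bound_def less_eq_ennreal.rep_eq times_ennreal.rep_eq enn2ereal_ennreal)

text \<open>The constant is 4 because the comparison with the level function costs a factor 2 and
  the dilation another 2. Both truncations are by \<open>\<delta>\<close>: values up to
  \<open>2 * \<delta>\<close> are discarded, and \<open>f\<close> is cut off at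
  \<open>n * \<delta>\<close>.\<close>

lemma norm_truncated_tail_integral_le:
  assumes I: "\<And>t. 0 < t \<Longrightarrow> 0 < I t" "mono_on {0<..} I"
    and X: "rearrangement_invariant_norm X" and Y: "rearrangement_invariant_norm Y"
    and C: "0 \<le> C"
    and bound: "\<And>f. f \<in> nonneg_space X \<Longrightarrow> nonincreasing f \<Longrightarrow> tail_bound I X Y C f"
    and f: "f \<in> nonneg_space X" and \<delta>: "0 < \<delta>"
  shows "Y (\<lambda>t. if 0 < t \<and> t \<le> 2 * \<delta> then 0 else tail_integral I (\<lambda>s. f s * indicator {0<..real n * \<delta>} s) t)
    \<le> ennreal (4 * C) * X f"
proof -
  have fM: "f \<in> M_plus" and fin: "X f < \<infinity>" using f by (auto simp: nonneg_space_def)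
  obtain a b where ab: "\<And>p. (\<integral>\<^sup>+t\<in>{real p * \<delta><..(real p + 1) * \<delta>}. f t \<partial>pos_lebesgue) = ennreal (a p) * ennreal \<delta>"
    "\<And>j. 0 \<le> a j" "\<And>j. 0 \<le> b j" "level_sequence 0 n a b" and Xb: "X (step \<delta> n b) \<le> X f"
    using ex_level_sequence_of_averages[OF X f \<delta>, of n] by blast
  let ?\<beta> = "step \<delta> n b"
  let ?H = "tail_integral I ?\<beta>"
  have H: "?H \<in> M_plus" by (rule M_plus_tail_integral[OF I])
  have P: "affine_pullback 2 (2 * \<delta>) ?H \<in> M_plus" by (rule M_plus_affine_pullback[OF H]) (use \<delta> in auto)
  have "nonincreasing ?\<beta>"
    by (rule nonincreasing_step[OF \<delta>])
      (use ab(4)[unfolded level_sequence_def, THEN conjunct2, THEN conjunct1] in blast)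
  moreover have "?\<beta> \<in> nonneg_space X" using Xb fin M_plus_step[OF \<delta>] by (auto simp: nonneg_space_def)
  ultimately have YH: "Y ?H \<le> ennreal C * X ?\<beta>" using bound tail_bound_iff[OF C] by blast
  have "Y (\<lambda>t. if 0 < t \<and> t \<le> 2 * \<delta> then 0 else tail_integral I (\<lambda>s. f s * indicator {0<..real n * \<delta>} s) t) \<le>
    Y (\<lambda>t. ennreal 2 * affine_pullback 2 (2 * \<delta>) ?H t)"
  \<comment> \<open>For \<open>t > 2 * \<delta>\<close> the pullback evaluates \<open>?H\<close> at
    \<open>(t - 2 * \<delta>) / 2\<close>, the point in the level comparison.\<close>
  proof (rule norm_mono[OF Y M_plus_interval_if[OF M_plus_const M_plus_tail_integral[OF I]] M_plus_cmult[OF P]])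
    fix t :: real assume "0 < t"
    show "(if 0 < t \<and> t \<le> 2 * \<delta> then 0 else tail_integral I (\<lambda>s. f s * indicator {0<..real n * \<delta>} s) t) \<le>
      ennreal 2 * affine_pullback 2 (2 * \<delta>) ?H t"
      using tail_integral_le_level[OF I fM \<delta> _ ab(1-4), of t] \<open>0 < t\<close>
      by (simp add: affine_pullback_def)
  qed
  also have "\<dots> = ennreal 2 * Y (affine_pullback 2 (2 * \<delta>) ?H)" by (rule norm_cmult[OF Y P]) simp
  also have "\<dots> \<le> ennreal 2 * (2 * Y ?H)"
  \<comment> \<open>The tail of a step function vanishes beyond its last cell, which supplies the
    bounded support for the dilation estimate.\<close>
  proof (intro mult_left_mono norm_dilation_le[OF Y H])
    show "?H t = 0" if "real n * \<delta> < t" for t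
      by (rule tail_integral_eq_0[OF I]) (use that in \<open>auto simp: step_eq\<close>)
  qed (use \<delta> in auto)
  also have "\<dots> \<le> ennreal 2 * (2 * (ennreal C * X f))"
    by (intro mult_left_mono order_trans[OF YH] mult_left_mono Xb) auto
  also have "\<dots> = ennreal (4 * C) * X f"
    using C by (simp add: ennreal_mult mult.assoc[symmetric])
  finally show ?thesis .
qed

text \<open>The truncated tail integrals increase to the full one, by monotone convergence for each
  \<open>t\<close>; the Fatou property of \<open>Y\<close> then carries over their uniform
  bound.\<close>

lemma tail_bound_of_nonincreasing:
  assumes I: "\<And>t. 0 < t \<Longrightarrow> 0 < I t" "mono_on {0<..} I"
    and X: "rearrangement_invariant_norm X" and Y: "rearrangement_invariant_norm Y"
    and bound: "\<And>f. f \<in> nonneg_space X \<Longrightarrow> nonincreasing f \<Longrightarrow> tail_bound I X Y C f"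
    and f: "f \<in> nonneg_space X"
  shows "tail_bound I X Y (4 * C) f"
proof -
  have C: "0 \<le> C" by (rule nonneg_tail_bound_constant[OF X bound])
  have fM: "f \<in> M_plus" using f by (auto simp: nonneg_space_def)
  \<comment> \<open>\<open>4 ^ i\<close> cells of length \<open>2 ^ (- i)\<close> fill
    \<open>(0, 2 ^ i]\<close>, so the cell length tends to 0 while the support grows to the whole
    half-line.\<close>
  define \<delta> :: "nat \<Rightarrow> real" where "\<delta> i = (1 / 2) ^ i" for i
  have \<delta>: "0 < \<delta> i" for i by (simp add: \<delta>_def)
  have \<delta>_le: "\<delta> j \<le> \<delta> i" if "i \<le> j" for i j
    unfolding \<delta>_def by (rule power_decreasing) (use that in auto)
  have n\<delta>: "real (4 ^ i) * \<delta> i = 2 ^ i" for i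
    unfolding \<delta>_def of_nat_power power_mult_distrib[symmetric] by simp
  define fi where "fi i s = f s * indicator {0<..2 ^ i} s" for i :: nat and s :: real
  define F where "F i t = (if 0 < t \<and> t \<le> 2 * \<delta> i then 0 else tail_integral I (fi i) t)" for i t
  have F: "F i \<in> M_plus" for i
    unfolding F_def[abs_def] by (rule M_plus_interval_if[OF M_plus_const M_plus_tail_integral[OF I]])
  have YF: "Y (F i) \<le> ennreal (4 * C) * X f" for i
    using norm_truncated_tail_integral_le[OF I X Y C bound f \<delta>, of i "4 ^ i"]
    unfolding n\<delta> F_def[abs_def] fi_def[abs_def] .
  have fi_mono: "fi i s \<le> fi j s" if "i \<le> j" for i j s
  proof -
    have "(2::real) ^ i \<le> 2 ^ j" using that by (intro power_increasing) auto
    then have "{0<..2 ^ i} \<subseteq> {0<..2 ^ j :: real}"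
      by (meson greaterThanAtMost_iff order_trans subsetI)
    then show ?thesis
      unfolding fi_def by (intro mult_left_mono indicator_leI) auto
  qed
  have tail_mono: "tail_integral I (fi i) t \<le> tail_integral I (fi j) t" if "i \<le> j" for i j t
    unfolding tail_integral_def
    by (intro nn_integral_mono mult_right_mono divide_right_mono_ennreal fi_mono[OF that]) simp
  have inc: "incseq (\<lambda>i. F i t)" for t
  proof (rule monoI)
    fix i j :: nat assume "i \<le> j"
    with tail_mono \<delta>_le[OF this] show "F i t \<le> F j t" by (auto simp: F_def)
  qed
  have fiM: "fi i \<in> M_plus" for i
    using measurable_times_indicator_Ioc[OF fM, of 0 "2 ^ i"] by (simp add: fi_def[abs_def] M_plus_def)
  have tail_lim: "(\<lambda>i. tail_integral I (fi i) t) \<longlonglongrightarrow> tail_integral I f t" if "0 < t" for t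
    unfolding tail_integral_def
  proof (rule nn_integral_LIMSEQ)
    show "incseq (\<lambda>i s. fi i s / ennreal (I s) * indicator {t<..} s)"
      by (intro monoI le_funI mult_right_mono divide_right_mono_ennreal fi_mono) auto
    have "{t<..} \<in> sets pos_lebesgue" using that by (auto simp: sets_pos_lebesgue_iff)
    then show "(\<lambda>s. fi i s / ennreal (I s) * indicator {t<..} s) \<in> borel_measurable pos_lebesgue" for i
      using M_plus_divide_I[OF I fiM] unfolding M_plus_def
      by (intro borel_measurable_times_ennreal borel_measurable_indicator)
    fix s
    show "(\<lambda>i. fi i s / ennreal (I s) * indicator {t<..} s) \<longlonglongrightarrow> f s / ennreal (I s) * indicator {t<..} s"
    proof (cases "t < s")
      case True
      obtain m :: nat where m: "s < 2 ^ m" using real_arch_pow[of 2 s] by auto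
      have "fi i s = f s" if "m \<le> i" for i
      proof -
        have "(2::real) ^ m \<le> 2 ^ i" using that by (intro power_increasing) auto
        with m have "s \<le> 2 ^ i" by linarith
        with True \<open>0 < t\<close> show ?thesis by (simp add: fi_def)
      qed
      then show ?thesis
        by (intro tendsto_eventually) (auto simp: eventually_sequentially intro!: exI[of _ m])
    qed simp
  qed
  have "(\<lambda>i. Y (F i)) \<longlonglongrightarrow> Y (tail_integral I f)"
  proof (rule norm_tendsto[OF Y F M_plus_tail_integral[OF I] inc])
    fix t :: real assume "0 < t"
    \<comment> \<open>From this index on the lower cutoff \<open>2 * \<delta> i\<close> lies below
      \<open>t\<close>.\<close>
    obtain m where m: "(1 / 2) ^ m < t / 2" using real_arch_pow_inv[of "t / 2" "1 / 2"] \<open>0 < t\<close> by auto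
    have "F i t = tail_integral I (fi i) t" if "m \<le> i" for i
    proof -
      have "2 * \<delta> i < t" using \<delta>_le[OF that] m unfolding \<delta>_def by linarith
      then show ?thesis by (simp add: F_def)
    qed
    then have "\<forall>\<^sub>F i in sequentially. tail_integral I (fi i) t = F i t"
      by (auto simp: eventually_sequentially intro!: exI[of _ m])
    with tail_lim[OF \<open>0 < t\<close>] show "(\<lambda>i. F i t) \<longlonglongrightarrow> tail_integral I f t"
      by (rule Lim_transform_eventually)
  qed
  then have "Y (tail_integral I f) \<le> ennreal (4 * C) * X f"
    by (rule LIMSEQ_le_const2) (use YF in auto)
  then show ?thesis using C by (simp add: tail_bound_iff)
qed

theorem theorem1p1:
  fixes I :: "real \<Rightarrow> real"
    and X Y :: "(real \<Rightarrow> ennreal) \<Rightarrow> ennreal"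
  assumes "\<And>t. t > 0 \<Longrightarrow> I t > 0"
    and "mono_on {0<..} I"
    and "rearrangement_invariant_norm X"
    and "rearrangement_invariant_norm Y"
  shows "((\<exists>C::real. \<forall>f\<in>nonneg_space X. tail_bound I X Y C f) \<longleftrightarrow>
          (\<exists>C'::real. \<forall>f\<in>nonneg_space X. nonincreasing f \<longrightarrow> tail_bound I X Y C' f)) \<and>
         (\<forall>C'::real. (\<forall>f\<in>nonneg_space X. nonincreasing f \<longrightarrow> tail_bound I X Y C' f) \<longrightarrow>
                     (\<forall>f\<in>nonneg_space X. tail_bound I X Y (4 * C') f))"
proof -
  have "\<forall>f\<in>nonneg_space X. tail_bound I X Y (4 * C') f"
    if "\<forall>f\<in>nonneg_space X. nonincreasing f \<longrightarrow> tail_bound I X Y C' f" for C'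
    using tail_bound_of_nonincreasing[OF assms] that by blast
  \<comment> \<open>Restricting to non-increasing functions gives one implication with the same
    constant; the converse holds with \<open>4 * C'\<close>.\<close>
  then show ?thesis by blast
qed

end
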